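(* Let $G=G(\Gamma)$ be a tubular group. (1) If $\Gamma$ is not just a single vertex (in which case $G\cong\mathbb{Z}^2$) nor a single vertex with a single self loop, then $G$ surjects $F_2$. (2) If $\Gamma$ is a single vertex with a single self loop, so that without loss of generality $$G=\langle x,y,t\mid [x,y],\ tx^it^{-1}=x^jy^k\rangle$$ for integers $i\neq 0$ and $j,k$ not both $0$, then $G$ surjects $F_2$ if and only if $k=0$. If $k\neq 0$ then $G$ has a subgroup of index $2$ surjecting $F_2$.
   Context: A tubular group $G=G(\Gamma)$ is the fundamental group of a graph of groups over a finite connected graph $\Gamma$ in which every vertex group is isomorphic to $\mathbb{Z}^2$ and every edge group is isomorphic to $\mathbb{Z}$. A self loop is an edge whose two endpoints are equal. $F_2$ is the free group of rank 2; a group surjects $F_2$ if it has a surjective homomorphism onto $F_2$. *)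

theory Defs
  imports "HOL-Algebra.Elementary_Groups" "Graph_Theory.Digraph_Component"
begin

section \<open>Group presentations and free groups\<close>

text \<open>
  A letter \<open>(a, True)\<close> stands for the generator \<open>a\<close>, and \<open>(a, False)\<close> for its formal inverse.
  A relation \<open>(r, s)\<close> stands for the equation \<open>r = s\<close>, that is, for the relator \<open>r s\<inverse>\<close>.
\<close>

type_synonym 'a gword = "('a \<times> bool) list"

definition gwords :: "'a set \<Rightarrow> 'a gword set" where
  "gwords S = lists (S \<times> UNIV)"

inductive pres_cong :: "'a set \<Rightarrow> ('a gword \<times> 'a gword) set \<Rightarrow> 'a gword \<Rightarrow> 'a gword \<Rightarrow> bool"
  for S R where
  pc_refl: "w \<in> gwords S \<Longrightarrow> pres_cong S R w w"
| pc_sym: "pres_cong S R u v \<Longrightarrow> pres_cong S R v u"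
| pc_trans: "pres_cong S R u v \<Longrightarrow> pres_cong S R v w \<Longrightarrow> pres_cong S R u w"
| pc_cancel: "u \<in> gwords S \<Longrightarrow> v \<in> gwords S \<Longrightarrow> a \<in> S
    \<Longrightarrow> pres_cong S R (u @ [(a, b), (a, \<not> b)] @ v) (u @ v)"
| pc_rel: "u \<in> gwords S \<Longrightarrow> v \<in> gwords S \<Longrightarrow> (r, s) \<in> R \<Longrightarrow> r \<in> gwords S \<Longrightarrow> s \<in> gwords S
    \<Longrightarrow> pres_cong S R (u @ r @ v) (u @ s @ v)"

definition pres_rel :: "'a set \<Rightarrow> ('a gword \<times> 'a gword) set \<Rightarrow> ('a gword \<times> 'a gword) set" where
  "pres_rel S R = {(u, v). pres_cong S R u v}"

definition presented_group :: "'a set \<Rightarrow> ('a gword \<times> 'a gword) set \<Rightarrow> 'a gword set monoid" where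
  "presented_group S R = \<lparr>carrier = gwords S // pres_rel S R,
     monoid.mult = (\<lambda>A B. \<Union>a\<in>A. \<Union>b\<in>B. pres_rel S R `` {a @ b}),
     one = pres_rel S R `` {[]}\<rparr>"

definition free_group :: "'a set \<Rightarrow> 'a gword set monoid" where
  "free_group S = presented_group S {}"

definition F2 :: "bool gword set monoid" where
  "F2 = free_group UNIV"

lemma gwords_simps [simp]:
  "[] \<in> gwords S"
  "x # u \<in> gwords S \<longleftrightarrow> fst x \<in> S \<and> u \<in> gwords S"
  "u @ v \<in> gwords S \<longleftrightarrow> u \<in> gwords S \<and> v \<in> gwords S"
  by (cases x; auto simp: gwords_def)+

lemma pres_cong_gwords:
  "pres_cong S R u v \<Longrightarrow> u \<in> gwords S \<and> v \<in> gwords S"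
  by (induction rule: pres_cong.induct) auto

lemma pres_cong_append_left:
  assumes "pres_cong S R u v" "w \<in> gwords S"
  shows "pres_cong S R (w @ u) (w @ v)"
  using assms
proof (induction rule: pres_cong.induct)
  case (pc_cancel u v a b)
  then show ?case using pres_cong.pc_cancel[of "w @ u" S v a R b] by simp
next
  case (pc_rel u v r s)
  then show ?case using pres_cong.pc_rel[of "w @ u" S v r s R] by simp
next
  case (pc_sym u v)
  then show ?case by (blast intro: pres_cong.pc_sym)
next
  case (pc_trans u v w')
  then show ?case by (blast intro: pres_cong.pc_trans)
qed (simp add: pc_refl)

lemma pres_cong_append_right:
  assumes "pres_cong S R u v" "w \<in> gwords S"
  shows "pres_cong S R (u @ w) (v @ w)"
  using assms
proof (induction rule: pres_cong.induct)
  case (pc_cancel u v a b)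
  then show ?case using pres_cong.pc_cancel[of u S "v @ w" a R b] by simp
next
  case (pc_rel u v r s)
  then show ?case using pres_cong.pc_rel[of u S "v @ w" r s R] by simp
next
  case (pc_sym u v)
  then show ?case by (blast intro: pres_cong.pc_sym)
next
  case (pc_trans u v w')
  then show ?case by (blast intro: pres_cong.pc_trans)
qed (simp add: pc_refl)

lemma equiv_pres_rel: "equiv (gwords S) (pres_rel S R)"
proof (rule equivI)
  show "pres_rel S R \<subseteq> gwords S \<times> gwords S"
    by (auto simp: pres_rel_def dest: pres_cong_gwords)
  show "refl_on (gwords S) (pres_rel S R)"
    by (rule refl_onI) (simp add: pres_rel_def pc_refl)
  show "sym (pres_rel S R)"
    by (rule symI) (simp add: pres_rel_def pc_sym)
  show "trans (pres_rel S R)"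
    by (rule transI) (metis (mono_tags) pres_rel_def pc_trans mem_Collect_eq case_prodI case_prodD)
qed

lemma pres_class_eq_iff:
  assumes "u \<in> gwords S" "v \<in> gwords S"
  shows "pres_rel S R `` {u} = pres_rel S R `` {v} \<longleftrightarrow> pres_cong S R u v"
  using eq_equiv_class_iff[OF equiv_pres_rel assms, of R] by (simp add: pres_rel_def)

lemma presented_group_mult:
  assumes "u \<in> gwords S" "v \<in> gwords S"
  shows "pres_rel S R `` {u} \<otimes>\<^bsub>presented_group S R\<^esub> pres_rel S R `` {v} = pres_rel S R `` {u @ v}"
proof -
  have *: "pres_rel S R `` {a @ b} = pres_rel S R `` {u @ v}"
    if "a \<in> pres_rel S R `` {u}" "b \<in> pres_rel S R `` {v}" for a b
  proof -
    have ab: "pres_cong S R u a" "pres_cong S R v b"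
      using that by (simp_all add: pres_rel_def)
    have "pres_cong S R (u @ v) (a @ b)"
      using pc_trans[OF pres_cong_append_right[OF ab(1) assms(2)]
          pres_cong_append_left[OF ab(2)]] pres_cong_gwords[OF ab(1)] by blast
    then show ?thesis
      using pres_class_eq_iff[of "u @ v" S "a @ b" R] pres_cong_gwords[of S R "u @ v" "a @ b"]
      by blast
  qed
  have "pres_rel S R `` {u} \<noteq> {}" "pres_rel S R `` {v} \<noteq> {}"
    using assms by (auto simp: pres_rel_def intro: pc_refl)
  then show ?thesis
    by (simp add: presented_group_def * del: Image_singleton_iff)
qed

lemma presented_group_carrier:
  "carrier (presented_group S R) = (\<lambda>u. pres_rel S R `` {u}) ` gwords S"
  by (auto simp: presented_group_def quotient_def)

lemma pres_cong_left_inverse: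
  "u \<in> gwords S \<Longrightarrow> pres_cong S R (rev (map (\<lambda>(a, b). (a, \<not> b)) u) @ u) []"
proof (induction u)
  case Nil
  then show ?case by (simp add: pc_refl)
next
  case (Cons x u)
  obtain a b where x: "x = (a, b)" by fastforce
  let ?i = "rev (map (\<lambda>(a, b). (a, \<not> b)) u)"
  have u: "u \<in> gwords S" "a \<in> S" using Cons.prems x by auto
  have "?i \<in> gwords S" using Cons.IH[OF u(1)] pres_cong_gwords by fastforce
  from pc_cancel[OF this u, of R "\<not> b"] Cons.IH[OF u(1)] show ?case
    by (auto simp: x intro: pc_trans)
qed

lemma group_presented_group: "group (presented_group S R)"
proof (rule groupI)
  show "\<one>\<^bsub>presented_group S R\<^esub> \<in> carrier (presented_group S R)"
    by (auto simp: presented_group_def intro: quotientI)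
next
  fix A B assume "A \<in> carrier (presented_group S R)" "B \<in> carrier (presented_group S R)"
  then show "A \<otimes>\<^bsub>presented_group S R\<^esub> B \<in> carrier (presented_group S R)"
    by (auto simp: presented_group_carrier presented_group_mult)
next
  fix A B C assume "A \<in> carrier (presented_group S R)" "B \<in> carrier (presented_group S R)"
    "C \<in> carrier (presented_group S R)"
  then show "A \<otimes>\<^bsub>presented_group S R\<^esub> B \<otimes>\<^bsub>presented_group S R\<^esub> C
    = A \<otimes>\<^bsub>presented_group S R\<^esub> (B \<otimes>\<^bsub>presented_group S R\<^esub> C)"
    by (auto simp: presented_group_carrier presented_group_mult)
next
  have one: "\<one>\<^bsub>presented_group S R\<^esub> = pres_rel S R `` {[]}"
    by (simp add: presented_group_def)
  fix A assume "A \<in> carrier (presented_group S R)"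
  then obtain u where u: "u \<in> gwords S" "A = pres_rel S R `` {u}"
    by (auto simp: presented_group_carrier)
  then show "\<one>\<^bsub>presented_group S R\<^esub> \<otimes>\<^bsub>presented_group S R\<^esub> A = A"
    by (simp add: one presented_group_mult)
  let ?v = "rev (map (\<lambda>(a, b). (a, \<not> b)) u)"
  have c: "pres_cong S R (?v @ u) []" by (rule pres_cong_left_inverse[OF u(1)])
  then have v: "?v \<in> gwords S" using pres_cong_gwords by fastforce
  have "pres_rel S R `` {?v} \<otimes>\<^bsub>presented_group S R\<^esub> A = pres_rel S R `` {?v @ u}"
    unfolding u(2) by (rule presented_group_mult[OF v u(1)])
  also have "\<dots> = pres_rel S R `` {[]}"
    using u v c pres_class_eq_iff[of "?v @ u" S "[]" R] by simp
  finally have "pres_rel S R `` {?v} \<otimes>\<^bsub>presented_group S R\<^esub> A = \<one>\<^bsub>presented_group S R\<^esub>"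
    unfolding one .
  then show "\<exists>B\<in>carrier (presented_group S R). B \<otimes>\<^bsub>presented_group S R\<^esub> A = \<one>\<^bsub>presented_group S R\<^esub>"
    using v unfolding presented_group_carrier by (intro bexI[OF _ imageI])
qed


section \<open>Graphs of groups and tubular groups\<close>

text \<open>
  The underlying graph is an undirected multigraph, possibly with loops. A \<open>pre_digraph\<close> records it
  together with an arbitrary choice of orientation, one arc per undirected edge; a self loop is an
  arc whose tail and head agree. The library's \<open>connected\<close> ignores the orientation, but its \<open>tree\<close>
  and \<open>spanning_tree\<close> exclude directed cycles only. Here cycles are taken in the
  graph obtained by adding to each arc its reverse, and may use each undirected edge once only.
\<close>

definition double_graph :: "('v, 'e) pre_digraph \<Rightarrow> ('v, 'e \<times> bool) pre_digraph" where
  "double_graph \<Gamma> = \<lparr>verts = verts \<Gamma>, arcs = arcs \<Gamma> \<times> UNIV,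
     tail = (\<lambda>(e, b). if b then tail \<Gamma> e else head \<Gamma> e),
     head = (\<lambda>(e, b). if b then head \<Gamma> e else tail \<Gamma> e)\<rparr>"

definition undirected_cycle :: "('v, 'e) pre_digraph \<Rightarrow> ('e \<times> bool) list \<Rightarrow> bool" where
  "undirected_cycle \<Gamma> p \<longleftrightarrow> pre_digraph.cycle (double_graph \<Gamma>) p \<and> distinct (map fst p)"

definition undirected_spanning_tree :: "('v, 'e) pre_digraph \<Rightarrow> ('v, 'e) pre_digraph \<Rightarrow> bool" where
  "undirected_spanning_tree T \<Gamma> \<longleftrightarrow>
     spanning T \<Gamma> \<and> Digraph_Component.connected T \<and> (\<nexists>p. undirected_cycle T p)"

definition single_vertex :: "('v, 'e) pre_digraph \<Rightarrow> bool" where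
  "single_vertex \<Gamma> \<longleftrightarrow> (\<exists>v. verts \<Gamma> = {v}) \<and> arcs \<Gamma> = {}"

definition single_self_loop :: "('v, 'e) pre_digraph \<Rightarrow> bool" where
  "single_self_loop \<Gamma> \<longleftrightarrow>
     (\<exists>v e. verts \<Gamma> = {v} \<and> arcs \<Gamma> = {e} \<and> tail \<Gamma> e = v \<and> head \<Gamma> e = v)"

locale graph_of_groups = fin_digraph \<Gamma> for \<Gamma> :: "('v, 'e) pre_digraph" +
  fixes VG :: "'v \<Rightarrow> 'g monoid" and EG :: "'e \<Rightarrow> 'h monoid"
    and tail_map head_map :: "'e \<Rightarrow> 'h \<Rightarrow> 'g"
  assumes connected_graph: "Digraph_Component.connected \<Gamma>"
    and vertex_group: "v \<in> verts \<Gamma> \<Longrightarrow> group (VG v)"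
    and edge_group: "e \<in> arcs \<Gamma> \<Longrightarrow> group (EG e)"
    and tail_mon: "e \<in> arcs \<Gamma> \<Longrightarrow> tail_map e \<in> mon (EG e) (VG (tail \<Gamma> e))"
    and head_mon: "e \<in> arcs \<Gamma> \<Longrightarrow> head_map e \<in> mon (EG e) (VG (head \<Gamma> e))"

abbreviation Z2 :: "(int \<times> int) monoid" where
  "Z2 \<equiv> integer_group \<times>\<times> integer_group"

locale tubular_graph_of_groups = graph_of_groups +
  assumes vertex_group_iso: "v \<in> verts \<Gamma> \<Longrightarrow> VG v \<cong> Z2"
    and edge_group_iso: "e \<in> arcs \<Gamma> \<Longrightarrow> EG e \<cong> integer_group"

text \<open>
  Serre's fundamental group \<open>\<pi>\<^sub>1(\<G>, \<Gamma>, T)\<close> with respect to a spanning tree \<open>T\<close>. The generators are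
  the elements of the vertex groups and one stable letter per edge. The relations are the
  multiplication tables of the vertex groups, \<open>e (head_map e c) e\<inverse> = tail_map e c\<close> for \<open>c\<close> in
  the edge group of \<open>e\<close>, and \<open>e = 1\<close> for the edges of \<open>T\<close>.
\<close>

definition fundamental_group ::
  "('v, 'e) pre_digraph \<Rightarrow> ('v \<Rightarrow> 'g monoid) \<Rightarrow> ('e \<Rightarrow> 'h monoid) \<Rightarrow> ('e \<Rightarrow> 'h \<Rightarrow> 'g) \<Rightarrow> ('e \<Rightarrow> 'h \<Rightarrow> 'g)
    \<Rightarrow> ('v, 'e) pre_digraph \<Rightarrow> ('v \<times> 'g + 'e) gword set monoid" where
  "fundamental_group \<Gamma> VG EG tail_map head_map T = presented_group
     ((SIGMA v:verts \<Gamma>. carrier (VG v)) <+> arcs \<Gamma>)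
     ({([(Inl (v, g), True), (Inl (v, h), True)], [(Inl (v, g \<otimes>\<^bsub>VG v\<^esub> h), True)]) | v g h.
         v \<in> verts \<Gamma> \<and> g \<in> carrier (VG v) \<and> h \<in> carrier (VG v)}
      \<union> {([(Inr e, True), (Inl (head \<Gamma> e, head_map e c), True), (Inr e, False)],
           [(Inl (tail \<Gamma> e, tail_map e c), True)]) | e c. e \<in> arcs \<Gamma> \<and> c \<in> carrier (EG e)}
      \<union> {([(Inr e, True)], []) | e. e \<in> arcs T})"


section \<open>The one-vertex, one-loop presentation\<close>

datatype loop_gen = Gen_x | Gen_y | Gen_t

definition gpow :: "'a \<Rightarrow> int \<Rightarrow> 'a gword" where
  "gpow a n = replicate (nat \<bar>n\<bar>) (a, n \<ge> 0)"

text \<open>The group \<open>\<langle>x, y, t | [x,y], t x\<^sup>i t\<inverse> = x\<^sup>j y\<^sup>k\<rangle>\<close>.\<close>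

definition loop_group :: "int \<Rightarrow> int \<Rightarrow> int \<Rightarrow> loop_gen gword set monoid" where
  "loop_group i j k = presented_group UNIV
     {([(Gen_x, True), (Gen_y, True), (Gen_x, False), (Gen_y, False)], []),
      ([(Gen_t, True)] @ gpow Gen_x i @ [(Gen_t, False)], gpow Gen_x j @ gpow Gen_y k)}"

definition surjects :: "('a, 'm) monoid_scheme \<Rightarrow> ('b, 'n) monoid_scheme \<Rightarrow> bool" where
  "surjects G H \<longleftrightarrow> (\<exists>f. f \<in> epi G H)"

end

theory Submission
  imports Defs Complex_Main
begin

text \<open>
  Write \<open>s\<close>, \<open>t\<close> for the free basis of \<open>F\<^sub>2\<close>, \<open>V\<close> for the vertex set and \<open>T\<close> for the spanning tree. A
  homomorphism to \<open>F\<^sub>2\<close> consists of homomorphisms on the vertex groups and images of the stable letters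
  that match the two images of each edge group. Which one to take depends on the number of arcs
  off \<open>T\<close>.

  With two such arcs, their stable letters go to \<open>s\<close> and \<open>t\<close> and everything else to \<open>1\<close>. With exactly
  one, its stable letter goes to \<open>t\<close>, and linear forms send the vertex groups to powers of \<open>s\<close>. The forms
  have to agree across the arcs of \<open>T\<close> and to vanish on both images of the remaining edge group; these
  are at most \<open>|V| + 1\<close> homogeneous linear equations in \<open>2 |V|\<close> integer unknowns, so for \<open>|V| \<ge> 2\<close> there
  is a nonzero solution, which can be made primitive. If the graph is a tree with at least two
  vertices, it has two leaves; their groups map onto the powers of \<open>s\<close> and of \<open>t\<close>, killing the attached
  edge groups. Both counts rest on \<open>|arcs T| < |V|\<close>, which itself follows from linear algebra: with
  more arcs there would be a nonzero integer flow, whose support contains a cycle (\<open>forest_card_arcs_less\<close>).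

  For a single loop, coordinates adapted to one image of the edge group give the presentation
  (\<open>iso_loop_group_if_single_self_loop\<close>). If \<open>k = 0\<close>, kill \<open>x\<close>. If \<open>k \<noteq> 0\<close>, an action on the real
  line excludes an epimorphism (\<open>loop_group_not_surjects_F2\<close>): in the affine action of \<open>F\<^sub>2\<close> in which \<open>s\<close> sends
  \<open>u\<close> to \<open>2 u\<close> and \<open>t\<close> sends \<open>u\<close> to \<open>3 u + 1\<close>, there is no global fixed point and the dilation factors do not form a cyclic group, whereas the relations of the
  loop group force one or the other. The subgroup of index two is that of the double cover of the
  loop, a circle with two vertices; its epimorphism is given by the linear system above and is
  expressed through the induced homomorphism from the whole group to the wreath product of \<open>F\<^sub>2\<close> with a
  group of order two (\<open>virtually_surjects_F2_of_iso_loop_group\<close>).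
\<close>

section \<open>Integer linear algebra\<close>

text \<open>
  Elimination without division. If the unknown \<open>p\<close> occurs in the equation \<open>j\<close>, cross-multiplying
  removes \<open>p\<close> from the other equations; a solution of the smaller system, scaled by the pivot
  \<open>A j p\<close>, leaves exactly one integer value for \<open>x p\<close>.
\<close>

lemma homogeneous_system_nontrivial_int_solution:
  fixes A :: "'j \<Rightarrow> 'i \<Rightarrow> int"
  assumes "finite J" "finite I" "card J < card I"
  shows "\<exists>x. (\<exists>i\<in>I. x i \<noteq> 0) \<and> (\<forall>j\<in>J. (\<Sum>i\<in>I. A j i * x i) = 0)"
  using assms
proof (induction J arbitrary: I A rule: finite_induct)
  case empty
  then obtain i where "i \<in> I" by (metis card.empty card_gt_0_iff ex_in_conv)
  then show ?case by (intro exI[of _ "\<lambda>_. 1"]) auto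
next
  case (insert j J)
  have cJ: "Suc (card J) < card I" using insert by simp
  show ?case
  proof (cases "\<forall>i\<in>I. A j i = 0")
    case True
    obtain x where "\<exists>i\<in>I. x i \<noteq> 0" "\<forall>k\<in>J. (\<Sum>i\<in>I. A k i * x i) = 0"
      using insert.IH[of I A] insert.prems cJ by auto
    then show ?thesis using True by (intro exI[of _ x]) (auto intro!: sum.neutral)
  next
    case False
    then obtain p where p: "p \<in> I" "A j p \<noteq> 0" by blast
    let ?I = "I - {p}"
    let ?B = "\<lambda>k i. A j p * A k i - A k p * A j i"
    have "card J < card ?I" using cJ p by simp
    then obtain z where z: "\<exists>i\<in>?I. z i \<noteq> 0" "\<forall>k\<in>J. (\<Sum>i\<in>?I. ?B k i * z i) = 0"
      using insert.IH[of ?I ?B] insert.prems(1) by blast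
    define x where "x i = (if i = p then - (\<Sum>i\<in>?I. A j i * z i) else A j p * z i)" for i
    have ev: "(\<Sum>i\<in>I. A k i * x i) = (\<Sum>i\<in>?I. ?B k i * z i)" for k
    proof -
      have "(\<Sum>i\<in>I. A k i * x i) = A k p * x p + (\<Sum>i\<in>?I. A k i * x i)"
        using p insert.prems by (simp add: sum.remove)
      also have "(\<Sum>i\<in>?I. A k i * x i) = (\<Sum>i\<in>?I. A k i * (A j p * z i))"
        by (rule sum.cong) (auto simp: x_def)
      finally show ?thesis
        by (simp add: x_def sum_distrib_left algebra_simps sum_subtractf sum_negf)
    qed
    have "(\<Sum>i\<in>I. A j i * x i) = 0" by (simp add: ev)
    moreover have "\<exists>i\<in>I. x i \<noteq> 0" using z(1) p by (auto simp: x_def)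
    ultimately show ?thesis using z(2) by (intro exI[of _ x]) (auto simp: ev)
  qed
qed

text \<open>
  Dividing by the common factor of the values keeps the solution integral. The coprimality is what
  later makes homomorphisms onto a free group surjective, instead of having only a non-abelian image.
\<close>

lemma homogeneous_system_primitive_int_solution:
  fixes A :: "'j \<Rightarrow> 'i \<Rightarrow> int"
  assumes "finite J" "finite I" "card J < card I"
  shows "\<exists>x. Gcd (x ` I) = 1 \<and> (\<forall>j\<in>J. (\<Sum>i\<in>I. A j i * x i) = 0)"
proof -
  obtain x i where x: "i \<in> I" "x i \<noteq> 0" "\<forall>j\<in>J. (\<Sum>i\<in>I. A j i * x i) = 0"
    using homogeneous_system_nontrivial_int_solution[OF assms, of A] by blast
  define d where "d = Gcd (x ` I)"
  have d0: "\<bar>d\<bar> = d" unfolding d_def by (rule abs_of_nonneg) simp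
  define z where "z i = x i div d" for i
  have d: "d \<noteq> 0" using x(1,2) by (auto simp: d_def)
  have "d dvd x i" if "i \<in> I" for i using that by (simp add: d_def Gcd_dvd)
  then have xz: "x i = d * z i" if "i \<in> I" for i using that by (simp add: z_def)
  have "x ` I = (*) d ` z ` I" unfolding image_image by (rule image_cong) (auto simp: xz)
  then have "d = normalize (d * Gcd (z ` I))" unfolding d_def by (metis Gcd_mult)
  then have "\<bar>d\<bar> * 1 = \<bar>d\<bar> * Gcd (z ` I)" using d0 by (simp add: abs_mult)
  then have g: "Gcd (z ` I) = 1" using d by simp
  have "(\<Sum>i\<in>I. A j i * x i) = d * (\<Sum>i\<in>I. A j i * z i)" for j
    unfolding sum_distrib_left by (rule sum.cong) (auto simp: xz)
  then show ?thesis using x(3) d g by (intro exI[of _ z]) auto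
qed

text \<open>
  Bezout's identity for a finite set of integers, in the form in which it is applied to the exponents
  \<open>n\<close> for which \<open>a\<^sup>n\<close> lies in a given subgroup.
\<close>

lemma Gcd_mem_additive_subgroup:
  fixes D :: "int set"
  assumes "finite A" "A \<subseteq> D" "0 \<in> D"
    and add: "\<And>a b. a \<in> D \<Longrightarrow> b \<in> D \<Longrightarrow> a + b \<in> D"
    and minus: "\<And>a. a \<in> D \<Longrightarrow> - a \<in> D"
  shows "Gcd A \<in> D"
proof -
  have nat: "int n * a \<in> D" if "a \<in> D" for n a
    using that by (induction n) (auto simp: assms algebra_simps)
  have mult: "u * a \<in> D" if "a \<in> D" for u a
    using nat[OF that, of "nat \<bar>u\<bar>"] minus[OF nat[OF that, of "nat \<bar>u\<bar>"]]
    by (cases "u \<ge> 0") auto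
  show ?thesis using assms(1,2)
  proof (induction A rule: finite_induct)
    case empty
    then show ?case by (simp add: assms)
  next
    case (insert a A)
    obtain u v where "u * a + v * Gcd A = gcd a (Gcd A)" using bezout_int by blast
    then show ?case using insert add[OF mult mult, of a "Gcd A" u v] by auto
  qed
qed

lemma triple_primitive_part:
  fixes a b c :: int
  assumes "a \<noteq> 0"
  obtains d a' b' c' where "a = d * a'" "b = d * b'" "c = d * c'" "d \<noteq> 0" "Gcd {a', b', c'} = 1"
proof -
  define d where "d = gcd a (gcd b c)"
  have d: "d \<noteq> 0" using assms by (simp add: d_def)
  have *: "d dvd a" "d dvd b" "d dvd c" by (auto simp: d_def intro: dvd_trans)
  obtain a' b' c' where e: "a = d * a'" "b = d * b'" "c = d * c'" using * unfolding dvd_def by blast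
  have "d = gcd (d * a') (gcd (d * b') (d * c'))" by (simp only: e[symmetric] d_def[symmetric])
  moreover have dd: "\<bar>d\<bar> = d" by (simp add: d_def)
  have "gcd (d * m) (d * n) = d * gcd m n" for m n by (simp add: gcd_mult_left abs_mult dd)
  ultimately have "Gcd {a', b', c'} = 1" using d by simp
  then show thesis using that e d by blast
qed

section \<open>Forests\<close>

text \<open>
  A flow assigns an integer to each arc so that at every vertex inflow and outflow agree. The
  divergences of any assignment add up to \<open>0\<close>, so it suffices to balance all vertices but one, and with
  at least as many arcs as vertices this leaves more unknowns than equations: there is a nonzero flow.
  Orient the arcs that carry flow in the direction of the flow. Whatever arrives at a vertex must
  leave it again, so one can walk on for ever in a finite graph and some walk closes up. The cycle
  inside it uses every arc in one direction only, hence no undirected edge twice.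
\<close>

lemma forest_card_arcs_less:
  fixes T :: "('v, 'e) pre_digraph"
  assumes wf: "wf_digraph T" and fin: "finite (verts T)" "finite (arcs T)"
    and ne: "verts T \<noteq> {}" and acyclic: "\<nexists>p. undirected_cycle T p"
  shows "card (arcs T) < card (verts T)"
proof (rule ccontr)
  assume le: "\<not> card (arcs T) < card (verts T)"
  interpret wf_digraph T by (rule wf)
  obtain r where r: "r \<in> verts T" using ne by blast
  define inc where
    "inc v e = (if head T e = v then 1 else 0) - (if tail T e = v then 1 else (0::int))" for v e
  have "card (verts T - {r}) < card (arcs T)"
    using le r fin by (metis card_Diff1_less linorder_not_less order_less_le_trans)
  then obtain x where x: "\<exists>e\<in>arcs T. x e \<noteq> 0"
    "\<And>v. v \<in> verts T - {r} \<Longrightarrow> (\<Sum>e\<in>arcs T. inc v e * x e) = 0"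
    using homogeneous_system_nontrivial_int_solution[of "verts T - {r}" "arcs T" inc] fin
    by auto
  have one: "(\<Sum>v\<in>verts T. inc v e) = 0" if "e \<in> arcs T" for e
    using that fin by (simp add: inc_def sum_subtractf)
  have "(\<Sum>v\<in>verts T. \<Sum>e\<in>arcs T. inc v e * x e) = (\<Sum>e\<in>arcs T. (\<Sum>v\<in>verts T. inc v e) * x e)"
    by (subst sum.swap) (simp add: sum_distrib_right)
  also have "\<dots> = 0" by (rule sum.neutral) (simp add: one)
  finally have "(\<Sum>e\<in>arcs T. inc r e * x e) = 0"
    using r fin x(2) by (subst (asm) sum.remove[of _ r]) auto
  then have flow: "(\<Sum>e\<in>arcs T. inc v e * x e) = 0" if "v \<in> verts T" for v
    using x(2)[of v] that by (cases "v = r") auto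
  \<comment> \<open>The arcs that carry flow, each with its flow direction only.\<close>
  define D where "D = (double_graph T)\<lparr>arcs := {(e, b). e \<in> arcs T \<and> x e \<noteq> 0 \<and> (b \<longleftrightarrow> x e > 0)}\<rparr>"
  have D: "verts D = verts T" "tail D = tail (double_graph T)" "head D = head (double_graph T)"
    "arcs D \<subseteq> arcs (double_graph T)"
    by (auto simp: D_def double_graph_def)
  interpret D: wf_digraph D
    by standard (auto simp: D_def double_graph_def split: if_splits)
  have arcD: "snd c \<longleftrightarrow> x (fst c) > 0" if "c \<in> arcs D" for c
    using that by (auto simp: D_def)
  have step: "\<exists>a\<in>arcs D. tail D a = head D c" if c: "c \<in> arcs D" for c
  proof -
    define v where "v = head D c"
    have v: "v \<in> verts T" using c D.head_in_verts by (simp add: v_def D)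
    obtain e b where e: "c = (e, b)" "e \<in> arcs T" "x e \<noteq> 0" "b \<longleftrightarrow> x e > 0"
      using c by (auto simp: D_def)
    show ?thesis
    proof (rule ccontr)
      assume "\<not> ?thesis"
      then have no: "tail D a \<noteq> v" if "a \<in> arcs D" for a using that by (auto simp: v_def)
      \<comment> \<open>If no flow left \<open>v\<close>, all terms of its balance would be nonnegative, and that of \<open>e\<close> positive.\<close>
      have nonneg: "inc v f * x f \<ge> 0" if f: "f \<in> arcs T" for f
      proof (cases "x f = 0")
        case False
        then have "(f, x f > 0) \<in> arcs D" using f by (auto simp: D_def)
        then show ?thesis using no[of "(f, x f > 0)"] False
          by (auto simp: D_def double_graph_def inc_def split: if_splits)
      qed simp
      have "inc v e * x e > 0"
        using e no[OF c] v_def by (auto simp: inc_def D_def double_graph_def split: if_splits)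
      moreover have "inc v e * x e = 0"
        using flow[OF v] nonneg sum_nonneg_eq_0_iff[of "arcs T" "\<lambda>f. inc v f * x f"] fin e(2)
        by blast
      ultimately show False by simp
    qed
  qed
  have "\<not> acyclic (arcs_ends D)"
  proof
    assume ac: "acyclic (arcs_ends D)"
    have "finite (arcs D)" using D(4) fin by (rule_tac finite_subset[OF D(4)]) (simp add: double_graph_def)
    then have "wf ((arcs_ends D)\<inverse>)"
      using ac by (intro finite_acyclic_wf_converse) (auto simp: arcs_ends_def)
    moreover obtain c where "c \<in> arcs D" using x(1) by (fastforce simp: D_def)
    ultimately obtain m where m: "m \<in> head D ` arcs D"
      "\<And>y. (y, m) \<in> (arcs_ends D)\<inverse> \<Longrightarrow> y \<notin> head D ` arcs D"
      by (metis imageI wfE_min)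
    then obtain a where "a \<in> arcs D" "tail D a = m" using step by blast
    then show False using m(2)[of "head D a"] by (auto simp: arcs_ends_def arc_to_ends_def)
  qed
  then obtain u where "(u, u) \<in> (arcs_ends D)\<^sup>+" by (auto simp: acyclic_def)
  then obtain p where "D.closed_w p"
    using D.reachable1_awalk by (auto simp: D.closed_w_def)
  then obtain q where q: "D.cycle q" using D.closed_w_imp_cycle by blast
  then obtain u where u: "D.awalk u q u" "distinct (tl (D.awalk_verts u q))" "distinct q" "q \<noteq> []"
    by (auto simp: D.cycle_conv)
  have compat: "compatible D (double_graph T)" by (simp add: compatible_def D)
  have "pre_digraph.cycle (double_graph T) q"
    unfolding pre_digraph.cycle_def pre_digraph.awalk_def
    using u D(1,4) compatible_cas[OF compat] compatible_awalk_verts[OF compat]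
    unfolding D.awalk_def by (auto simp: double_graph_def)
  moreover have "inj_on fst (set q)"
  proof (rule inj_onI)
    fix c c' assume c: "c \<in> set q" "c' \<in> set q" "fst c = fst c'"
    moreover have "set q \<subseteq> arcs D" using u(1) by (simp add: D.awalk_def)
    ultimately have "snd c = (x (fst c) > 0)" "snd c' = (x (fst c') > 0)"
      using arcD by blast+
    then show "c = c'" using c(3) by (simp add: prod_eq_iff)
  qed
  ultimately have "undirected_cycle T q"
    using u(3) by (simp add: undirected_cycle_def distinct_map)
  then show False using acyclic by blast
qed

section \<open>Homomorphisms out of presented groups\<close>

definition word_eval :: "('b, 'm) monoid_scheme \<Rightarrow> ('a \<Rightarrow> 'b) \<Rightarrow> 'a gword \<Rightarrow> 'b" where
  "word_eval H \<phi> w =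
     foldr (\<lambda>(a, b) z. (if b then \<phi> a else inv\<^bsub>H\<^esub> \<phi> a) \<otimes>\<^bsub>H\<^esub> z) w \<one>\<^bsub>H\<^esub>"

lemma word_eval_simps [simp]:
  "word_eval H \<phi> [] = \<one>\<^bsub>H\<^esub>"
  "word_eval H \<phi> ((a, b) # w) = (if b then \<phi> a else inv\<^bsub>H\<^esub> \<phi> a) \<otimes>\<^bsub>H\<^esub> word_eval H \<phi> w"
  by (simp_all add: word_eval_def)

context group
begin

lemma word_eval_closed:
  "\<phi> \<in> S \<rightarrow> carrier G \<Longrightarrow> w \<in> gwords S \<Longrightarrow> word_eval G \<phi> w \<in> carrier G"
  by (induction w) (auto simp: Pi_iff)

lemma word_eval_append:
  "\<phi> \<in> S \<rightarrow> carrier G \<Longrightarrow> u \<in> gwords S \<Longrightarrow> v \<in> gwords S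
    \<Longrightarrow> word_eval G \<phi> (u @ v) = word_eval G \<phi> u \<otimes> word_eval G \<phi> v"
proof (induction u)
  case (Cons x u)
  then show ?case
    by (cases x) (auto simp: m_assoc word_eval_closed Pi_iff)
qed (simp add: word_eval_closed)

lemma word_eval_gpow:
  assumes "\<phi> \<in> S \<rightarrow> carrier G" "a \<in> S"
  shows "word_eval G \<phi> (gpow a n) = \<phi> a [^] n"
proof -
  have a: "\<phi> a \<in> carrier G" using assms by auto
  have rep: "word_eval G \<phi> (replicate m (a, b)) = (if b then \<phi> a else inv \<phi> a) [^] m" for m b
    by (induction m) (use a in \<open>auto simp flip: nat_pow_Suc2 simp del: nat_pow_Suc\<close>)
  show ?thesis
  proof (cases "n < 0")
    case True
    then show ?thesis using a nat_pow_inv[of "\<phi> a" "nat (- n)"]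
      by (simp only: gpow_def rep int_pow_def2) simp
  next
    case False
    then show ?thesis by (simp only: gpow_def rep int_pow_def2) simp
  qed
qed

lemma word_eval_pres_cong:
  assumes "pres_cong S R u v" "\<phi> \<in> S \<rightarrow> carrier G"
    and rels: "\<And>r s. (r, s) \<in> R \<Longrightarrow> word_eval G \<phi> r = word_eval G \<phi> s"
  shows "word_eval G \<phi> u = word_eval G \<phi> v"
  using assms(1)
proof (induction rule: pres_cong.induct)
  case (pc_cancel u v a b)
  then have "\<phi> a \<in> carrier G" using assms(2) by auto
  moreover have "(if b then \<phi> a else inv \<phi> a) \<otimes> ((if \<not> b then \<phi> a else inv \<phi> a) \<otimes> z) = z"
    if "z \<in> carrier G" for z
    using that \<open>\<phi> a \<in> carrier G\<close> by (simp add: m_assoc[symmetric])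
  ultimately show ?case
    using pc_cancel assms(2) by (simp add: word_eval_append word_eval_closed)
next
  case (pc_rel u v r s)
  then show ?case using assms(2) rels by (simp add: word_eval_append)
qed auto

end

text \<open>
  The universal property of a presentation: evaluation of words respects the congruence, so it can be
  carried out on an arbitrary representative of a class.
\<close>

lemma presented_group_hom_exists:
  assumes "group H" "\<phi> \<in> S \<rightarrow> carrier H"
    and "\<And>r s. (r, s) \<in> R \<Longrightarrow> word_eval H \<phi> r = word_eval H \<phi> s"
  shows "\<exists>h\<in>hom (presented_group S R) H. \<forall>w\<in>gwords S. h (pres_rel S R `` {w}) = word_eval H \<phi> w"
proof -
  interpret H: group H by fact
  define h where "h A = word_eval H \<phi> (SOME w. w \<in> A)" for A
  have h: "h (pres_rel S R `` {w}) = word_eval H \<phi> w" if "w \<in> gwords S" for w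
  proof -
    have "w \<in> pres_rel S R `` {w}" using that by (simp add: pres_rel_def pc_refl)
    then have "(SOME z. z \<in> pres_rel S R `` {w}) \<in> pres_rel S R `` {w}" by (rule someI)
    then have "pres_cong S R w (SOME z. z \<in> pres_rel S R `` {w})" by (simp add: pres_rel_def)
    then show ?thesis using H.word_eval_pres_cong[OF _ assms(2,3)] by (simp add: h_def)
  qed
  have "h \<in> hom (presented_group S R) H"
    using assms(2)
    by (auto intro!: homI simp: presented_group_carrier presented_group_mult h
        H.word_eval_closed H.word_eval_append)
  then show ?thesis using h by blast
qed

abbreviation pgen :: "'a set \<Rightarrow> ('a gword \<times> 'a gword) set \<Rightarrow> 'a \<Rightarrow> 'a gword set" where
  "pgen S R a \<equiv> pres_rel S R `` {[(a, True)]}"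

lemma presented_group_one: "\<one>\<^bsub>presented_group S R\<^esub> = pres_rel S R `` {[]}"
  by (simp add: presented_group_def)

lemma pgen_in_carrier: "pgen S R \<in> S \<rightarrow> carrier (presented_group S R)"
  by (auto simp: presented_group_carrier)

lemma word_eval_pgen:
  "w \<in> gwords S \<Longrightarrow> word_eval (presented_group S R) (pgen S R) w = pres_rel S R `` {w}"
proof (induction w)
  case Nil
  then show ?case by (simp add: presented_group_one)
next
  case (Cons x w)
  obtain a b where x: "x = (a, b)" by fastforce
  interpret P: group "presented_group S R" by (rule group_presented_group)
  have a: "a \<in> S" "w \<in> gwords S" using Cons.prems x by auto
  have "pres_rel S R `` {[(a, False)]} \<otimes>\<^bsub>presented_group S R\<^esub> pgen S R a = \<one>\<^bsub>presented_group S R\<^esub>"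
    using pc_cancel[of "[]" S "[]" a R False] a
    by (simp add: presented_group_mult presented_group_one pres_class_eq_iff)
  then have "inv\<^bsub>presented_group S R\<^esub> pgen S R a = pres_rel S R `` {[(a, False)]}"
    using a by (intro P.inv_equality) (auto simp: presented_group_carrier)
  then have "(if b then pgen S R a else inv\<^bsub>presented_group S R\<^esub> pgen S R a)
      = pres_rel S R `` {[(a, b)]}" by simp
  then show ?case
    using Cons.IH a by (simp add: x presented_group_mult)
qed

lemma word_eval_pgen_rel:
  assumes "(r, s) \<in> R" "r \<in> gwords S" "s \<in> gwords S"
  shows "word_eval (presented_group S R) (pgen S R) r = word_eval (presented_group S R) (pgen S R) s"
  using pc_rel[of "[]" S "[]" r s R] assms by (simp add: word_eval_pgen pres_class_eq_iff)

lemma (in group_hom) hom_word_eval: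
  "\<phi> \<in> S \<rightarrow> carrier G \<Longrightarrow> w \<in> gwords S \<Longrightarrow> h (word_eval G \<phi> w) = word_eval H (h \<circ> \<phi>) w"
proof (induction w)
  case (Cons x w)
  then show ?case by (cases x) (auto simp: G.word_eval_closed Pi_iff)
qed simp

lemma group_hom_presented_group:
  "group H \<Longrightarrow> h \<in> hom (presented_group S R) H \<Longrightarrow> group_hom (presented_group S R) H h"
  by (simp add: group_hom_def group_hom_axioms_def group_presented_group)

lemma hom_presented_group_eq_word_eval:
  assumes "group H" "h \<in> hom (presented_group S R) H" "w \<in> gwords S"
  shows "h (pres_rel S R `` {w}) = word_eval H (h \<circ> pgen S R) w"
  using group_hom.hom_word_eval[OF group_hom_presented_group[OF assms(1,2)] pgen_in_carrier assms(3)]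
    assms(3) by (simp add: word_eval_pgen)

lemma word_eval_in_subgroup:
  assumes "subgroup K H" "group H" "\<phi> \<in> S \<rightarrow> K" "w \<in> gwords S"
  shows "word_eval H \<phi> w \<in> K"
  using assms(3,4)
  by (induction w) (auto simp: subgroup.one_closed[OF assms(1)] Pi_iff
      intro!: subgroup.m_closed[OF assms(1)] subgroup.m_inv_closed[OF assms(1)])

text \<open>
  A homomorphism from a presented group is controlled by the generators. For a stabilizer as the
  subgroup, this turns a common fixed point of the generators into a global fixed point.
\<close>

lemma hom_presented_group_in_subgroup:
  assumes "group H" "h \<in> hom (presented_group S R) H" "subgroup K H"
    and "\<And>a. a \<in> S \<Longrightarrow> h (pgen S R a) \<in> K" and "A \<in> carrier (presented_group S R)"
  shows "h A \<in> K"
proof -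
  obtain w where w: "w \<in> gwords S" "A = pres_rel S R `` {w}"
    using assms(5) by (auto simp: presented_group_carrier)
  have "word_eval H (h \<circ> pgen S R) w \<in> K"
    using assms(4) by (intro word_eval_in_subgroup[OF assms(3,1) _ w(1)]) auto
  then show ?thesis using hom_presented_group_eq_word_eval[OF assms(1,2) w(1)] w(2) by simp
qed

lemma presented_group_endo_eq_id:
  assumes h: "h \<in> hom (presented_group S R) (presented_group S R)"
    and gen: "\<And>a. a \<in> S \<Longrightarrow> h (pgen S R a) = pgen S R a"
    and A: "A \<in> carrier (presented_group S R)"
  shows "h A = A"
proof -
  let ?P = "presented_group S R"
  obtain w where w: "w \<in> gwords S" "A = pres_rel S R `` {w}"
    using A by (auto simp: presented_group_carrier)
  have eq: "word_eval ?P \<psi> w = word_eval ?P \<chi> w" if "\<And>a. a \<in> S \<Longrightarrow> \<psi> a = \<chi> a" for \<psi> \<chi>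
    using w(1) that by (induction w) auto
  have "h A = word_eval ?P (h \<circ> pgen S R) w"
    unfolding w(2) by (rule hom_presented_group_eq_word_eval[OF group_presented_group h w(1)])
  also have "\<dots> = word_eval ?P (pgen S R) w" by (rule eq) (simp add: gen)
  finally show ?thesis using w by (simp add: word_eval_pgen)
qed

lemma is_iso_if_homs_mutually_inverse:
  assumes "f \<in> hom G H" "g \<in> hom H G"
    and "\<And>x. x \<in> carrier G \<Longrightarrow> g (f x) = x" "\<And>y. y \<in> carrier H \<Longrightarrow> f (g y) = y"
  shows "G \<cong> H"
proof -
  have "bij_betw f (carrier G) (carrier H)"
    using assms by (intro bij_betw_byWitness[of _ g]) (auto simp: hom_def)
  then show ?thesis using assms(1) by (intro is_isoI[of f]) (simp add: iso_def)
qed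

section \<open>The free group of rank two\<close>

text \<open>
  The free basis. In the explanations below, \<open>s\<close> is \<open>F2gen True\<close> and \<open>t\<close> is \<open>F2gen False\<close>.
\<close>

abbreviation F2gen :: "bool \<Rightarrow> bool gword set" where
  "F2gen \<equiv> pgen UNIV {}"

lemma group_F2: "group F2"
  by (simp add: F2_def free_group_def group_presented_group)

lemma F2gen_carrier [simp]: "F2gen b \<in> carrier F2"
  unfolding F2_def free_group_def by (rule funcset_mem[OF pgen_in_carrier]) simp

lemma F2_hom_exists:
  assumes "group H" "s \<in> carrier H" "t \<in> carrier H"
  obtains h where "h \<in> hom F2 H" "h (F2gen True) = s" "h (F2gen False) = t"
proof -
  interpret H: group H by fact
  have "(\<lambda>b. if b then s else t) \<in> UNIV \<rightarrow> carrier H" using assms by auto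
  from presented_group_hom_exists[OF assms(1) this, of "{}"]
  obtain h where "h \<in> hom F2 H"
    "\<forall>w\<in>gwords UNIV. h (pres_rel UNIV {} `` {w}) = word_eval H (\<lambda>b. if b then s else t) w"
    unfolding F2_def free_group_def by fast
  then show thesis using that[of h] assms by simp
qed

lemma subgroup_F2_eq_carrier:
  assumes "subgroup K F2" "F2gen True \<in> K" "F2gen False \<in> K"
  shows "K = carrier F2"
proof -
  have "F2gen b \<in> K" for b using assms by (cases b) auto
  moreover have "(\<lambda>x. x) \<in> hom F2 F2" by (simp add: hom_def)
  ultimately have "A \<in> K" if "A \<in> carrier F2" for A
    using hom_presented_group_in_subgroup[of F2 "\<lambda>x. x" UNIV "{}" K A] that assms(1) group_F2
    by (simp add: F2_def free_group_def)
  then show ?thesis using assms(1) by (auto dest: subgroup.mem_carrier)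
qed

lemma hom_onto_F2I:
  assumes "group G" "h \<in> hom G F2"
    and "F2gen True \<in> h ` carrier G" "F2gen False \<in> h ` carrier G"
  shows "surjects G F2"
proof -
  interpret group_hom G F2 h
    using assms group_F2 by (simp add: group_hom_def group_hom_axioms_def)
  have "h ` carrier G = carrier F2"
    by (rule subgroup_F2_eq_carrier) (use assms img_is_subgroup in auto)
  then show ?thesis using assms(2) unfolding surjects_def epi_def by blast
qed

text \<open>
  The exponents \<open>n\<close> with \<open>a\<^sup>n \<in> K\<close> form a subgroup of the integers; it contains numbers without a
  common factor, hence \<open>1\<close>.
\<close>

lemma (in group) generator_in_subgroup_if_coprime_powers:
  assumes K: "subgroup K G" and a: "a \<in> carrier G" and "finite A" "Gcd A = 1"
    and pow: "\<And>n. n \<in> A \<Longrightarrow> a [^] (n::int) \<in> K"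
  shows "a \<in> K"
proof -
  let ?D = "{n::int. a [^] n \<in> K}"
  have "Gcd A \<in> ?D"
  proof (rule Gcd_mem_additive_subgroup[OF assms(3)])
    show "A \<subseteq> ?D" using pow by auto
    show "0 \<in> ?D" using subgroup.one_closed[OF K] by simp
    show "m + n \<in> ?D" if "m \<in> ?D" "n \<in> ?D" for m n
      using subgroup.m_closed[OF K] that a by (simp add: int_pow_mult)
    show "- n \<in> ?D" if "n \<in> ?D" for n
      using subgroup.m_inv_closed[OF K] that a by (simp add: int_pow_neg)
  qed
  then show ?thesis using a unfolding assms(4) by (simp only: mem_Collect_eq int_pow_1)
qed

lemma surjects_F2_if_coprime_powers:
  fixes A :: "bool \<Rightarrow> int set"
  assumes "group G" "h \<in> hom G F2" "\<And>b. finite (A b)" "\<And>b. Gcd (A b) = 1"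
    and "\<And>b n. n \<in> A b \<Longrightarrow> F2gen b [^]\<^bsub>F2\<^esub> n \<in> h ` carrier G"
  shows "surjects G F2"
proof -
  interpret F: group F2 by (rule group_F2)
  interpret group_hom G F2 h
    using assms(1,2) group_F2 by (simp add: group_hom_def group_hom_axioms_def)
  have "F2gen b \<in> h ` carrier G" for b
    using F.generator_in_subgroup_if_coprime_powers[OF img_is_subgroup F2gen_carrier assms(3,4,5)] .
  then show ?thesis by (intro hom_onto_F2I[OF assms(1,2)])
qed

lemma surjects_iso:
  assumes "G \<cong> H" "surjects H K"
  shows "surjects G K"
proof -
  obtain f g where "f \<in> iso G H" "g \<in> epi H K"
    using assms by (auto simp: is_iso_def surjects_def)
  then have "g \<circ> f \<in> epi G K" by (intro epi_compose[of f G H]) (simp_all add: iso_iff_mon_epi)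
  then show ?thesis by (auto simp: surjects_def)
qed

section \<open>Homomorphisms out of the loop groups\<close>

abbreviation loop_rels :: "int \<Rightarrow> int \<Rightarrow> int \<Rightarrow> (loop_gen gword \<times> loop_gen gword) set" where
  "loop_rels i j k \<equiv>
     {([(Gen_x, True), (Gen_y, True), (Gen_x, False), (Gen_y, False)], []),
      ([(Gen_t, True)] @ gpow Gen_x i @ [(Gen_t, False)], gpow Gen_x j @ gpow Gen_y k)}"

lemma gwords_UNIV [simp]: "w \<in> gwords UNIV"
  by (simp add: gwords_def)

text \<open>
  The relators are rewritten without inverses, because the groups below have simple products but
  clumsy inverses.
\<close>

lemma (in group) word_eval_loop_rels:
  fixes i j k :: int
  assumes "\<phi> \<in> UNIV \<rightarrow> carrier G"
  shows "(\<forall>(r, s)\<in>loop_rels i j k. word_eval G \<phi> r = word_eval G \<phi> s) \<longleftrightarrow>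
    \<phi> Gen_x \<otimes> \<phi> Gen_y = \<phi> Gen_y \<otimes> \<phi> Gen_x \<and>
    \<phi> Gen_t \<otimes> \<phi> Gen_x [^] i = \<phi> Gen_x [^] j \<otimes> \<phi> Gen_y [^] k \<otimes> \<phi> Gen_t"
proof -
  have c: "\<phi> a \<in> carrier G" for a using assms by auto
  have "\<phi> Gen_x \<otimes> (\<phi> Gen_y \<otimes> (inv \<phi> Gen_x \<otimes> inv \<phi> Gen_y)) = \<one> \<longleftrightarrow>
      \<phi> Gen_x \<otimes> \<phi> Gen_y = \<phi> Gen_y \<otimes> \<phi> Gen_x"
    using c inv_solve_right'[of "\<one>" "\<phi> Gen_x \<otimes> \<phi> Gen_y" "\<phi> Gen_y \<otimes> \<phi> Gen_x"]
    by (simp add: m_assoc inv_mult_group)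
  moreover have "\<phi> Gen_t \<otimes> (\<phi> Gen_x [^] i \<otimes> inv \<phi> Gen_t) = \<phi> Gen_x [^] j \<otimes> \<phi> Gen_y [^] k \<longleftrightarrow>
      \<phi> Gen_t \<otimes> \<phi> Gen_x [^] i = \<phi> Gen_x [^] j \<otimes> \<phi> Gen_y [^] k \<otimes> \<phi> Gen_t"
    using c inv_solve_right'[of "\<phi> Gen_x [^] j \<otimes> \<phi> Gen_y [^] k" "\<phi> Gen_t \<otimes> \<phi> Gen_x [^] i" "\<phi> Gen_t"]
    by (simp add: m_assoc)
  ultimately show ?thesis
    using c by (simp add: word_eval_append[OF assms] word_eval_gpow[OF assms])
qed

lemma loop_group_hom_exists:
  fixes i j k :: int
  assumes "group H" and c: "x \<in> carrier H" "y \<in> carrier H" "t \<in> carrier H"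
    and "x \<otimes>\<^bsub>H\<^esub> y = y \<otimes>\<^bsub>H\<^esub> x"
    and "t \<otimes>\<^bsub>H\<^esub> x [^]\<^bsub>H\<^esub> i = x [^]\<^bsub>H\<^esub> j \<otimes>\<^bsub>H\<^esub> y [^]\<^bsub>H\<^esub> k \<otimes>\<^bsub>H\<^esub> t"
  obtains h where "h \<in> hom (loop_group i j k) H"
    "h (pgen UNIV (loop_rels i j k) Gen_x) = x"
    "h (pgen UNIV (loop_rels i j k) Gen_y) = y"
    "h (pgen UNIV (loop_rels i j k) Gen_t) = t"
proof -
  interpret H: group H by fact
  define \<phi> where "\<phi> = case_loop_gen x y t"
  have \<phi>: "\<phi> \<in> UNIV \<rightarrow> carrier H" using c by (auto simp: \<phi>_def split: loop_gen.split)
  have "\<forall>(r, s)\<in>loop_rels i j k. word_eval H \<phi> r = word_eval H \<phi> s"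
    unfolding H.word_eval_loop_rels[OF \<phi>] using assms by (simp add: \<phi>_def)
  then have rels: "\<And>r s. (r, s) \<in> loop_rels i j k \<Longrightarrow> word_eval H \<phi> r = word_eval H \<phi> s" by blast
  have "\<exists>h\<in>hom (loop_group i j k) H.
      \<forall>w\<in>gwords UNIV. h (pres_rel UNIV (loop_rels i j k) `` {w}) = word_eval H \<phi> w"
    unfolding loop_group_def by (rule presented_group_hom_exists[OF assms(1) \<phi> rels])
  then obtain h where h: "h \<in> hom (loop_group i j k) H"
    "\<forall>w\<in>gwords UNIV. h (pres_rel UNIV (loop_rels i j k) `` {w}) = word_eval H \<phi> w"
    by (rule bexE)
  have gens: "h (pgen UNIV (loop_rels i j k) a) = \<phi> a" for a
    using bspec[OF h(2) gwords_UNIV, of "[(a, True)]"] funcset_mem[OF \<phi>, of a] by simp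
  show thesis by (rule that[OF h(1)]) (simp_all only: gens, simp_all add: \<phi>_def)
qed

lemma loop_group_hom_relations:
  fixes i j k :: int
  assumes "group H" "h \<in> hom (loop_group i j k) H"
  defines "\<phi> \<equiv> h \<circ> pgen UNIV (loop_rels i j k)"
  shows "\<phi> a \<in> carrier H"
    and "\<phi> Gen_x \<otimes>\<^bsub>H\<^esub> \<phi> Gen_y = \<phi> Gen_y \<otimes>\<^bsub>H\<^esub> \<phi> Gen_x"
    and "\<phi> Gen_t \<otimes>\<^bsub>H\<^esub> \<phi> Gen_x [^]\<^bsub>H\<^esub> i
      = \<phi> Gen_x [^]\<^bsub>H\<^esub> j \<otimes>\<^bsub>H\<^esub> \<phi> Gen_y [^]\<^bsub>H\<^esub> k \<otimes>\<^bsub>H\<^esub> \<phi> Gen_t"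
proof -
  interpret H: group H by fact
  have h: "h \<in> hom (presented_group UNIV (loop_rels i j k)) H"
    using assms(2) by (simp add: loop_group_def)
  have \<phi>: "\<phi> \<in> UNIV \<rightarrow> carrier H"
    using hom_in_carrier[OF h] pgen_in_carrier[of UNIV "loop_rels i j k"] by (auto simp: \<phi>_def Pi_iff)
  have "word_eval H \<phi> r = word_eval H \<phi> s" if "(r, s) \<in> loop_rels i j k" for r s
    unfolding \<phi>_def hom_presented_group_eq_word_eval[OF assms(1) h gwords_UNIV, symmetric]
    using word_eval_pgen_rel[OF that] by (simp add: word_eval_pgen)
  then have "\<forall>(r, s)\<in>loop_rels i j k. word_eval H \<phi> r = word_eval H \<phi> s" by blast
  then show "\<phi> Gen_x \<otimes>\<^bsub>H\<^esub> \<phi> Gen_y = \<phi> Gen_y \<otimes>\<^bsub>H\<^esub> \<phi> Gen_x"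
    "\<phi> Gen_t \<otimes>\<^bsub>H\<^esub> \<phi> Gen_x [^]\<^bsub>H\<^esub> i
      = \<phi> Gen_x [^]\<^bsub>H\<^esub> j \<otimes>\<^bsub>H\<^esub> \<phi> Gen_y [^]\<^bsub>H\<^esub> k \<otimes>\<^bsub>H\<^esub> \<phi> Gen_t"
    unfolding H.word_eval_loop_rels[OF \<phi>] by blast+
  show "\<phi> a \<in> carrier H" using \<phi> by blast
qed

text \<open>
  For \<open>k = 0\<close> the generator \<open>y\<close> occurs in the commutator only, so \<open>x\<close> may be killed.
\<close>

lemma loop_group_surjects_F2:
  "surjects (loop_group i j 0) F2"
proof -
  interpret F: group F2 by (rule group_F2)
  obtain h where h: "h \<in> hom (loop_group i j 0) F2"
    "h (pgen UNIV (loop_rels i j 0) Gen_y) = F2gen True"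
    "h (pgen UNIV (loop_rels i j 0) Gen_t) = F2gen False"
    by (rule loop_group_hom_exists[OF group_F2, of "\<one>\<^bsub>F2\<^esub>" "F2gen True" "F2gen False" i j 0]) auto
  have "pgen UNIV (loop_rels i j 0) a \<in> carrier (loop_group i j 0)" for a
    unfolding loop_group_def by (rule funcset_mem[OF pgen_in_carrier]) simp
  then show ?thesis
    using h group_presented_group
    by (intro hom_onto_F2I[of _ h]) (auto simp: loop_group_def intro: image_eqI[OF sym])
qed

section \<open>Affine actions on the line\<close>

text \<open>
  The pair \<open>(l, b)\<close> stands for the map \<open>u \<mapsto> e\<^sup>l u + b\<close> of the real line, with composition as product.
  Recording the logarithm \<open>l\<close> of the dilation factor makes it additive and every pair admissible.
\<close>

definition affine_group :: "(real \<times> real) monoid" where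
  "affine_group = \<lparr>carrier = UNIV,
     monoid.mult = (\<lambda>(l, b) (l', b'). (l + l', exp l * b' + b)), one = (0, 0)\<rparr>"

lemma affine_group_simps [simp]:
  "carrier affine_group = UNIV"
  "(l, b) \<otimes>\<^bsub>affine_group\<^esub> (l', b') = (l + l', exp l * b' + b)"
  "\<one>\<^bsub>affine_group\<^esub> = (0, 0)"
  by (simp_all add: affine_group_def)

lemma group_affine_group: "group affine_group"
proof (rule groupI)
  show "\<exists>y\<in>carrier affine_group. y \<otimes>\<^bsub>affine_group\<^esub> x = \<one>\<^bsub>affine_group\<^esub>" for x
    by (rule bexI[of _ "(- fst x, - exp (- fst x) * snd x)"]; cases x) simp_all
qed (auto simp: exp_add algebra_simps)

lemma fst_affine_mult [simp]: "fst (g \<otimes>\<^bsub>affine_group\<^esub> h) = fst g + fst h"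
  by (cases g; cases h) simp

lemma fst_affine_int_pow: "fst (g [^]\<^bsub>affine_group\<^esub> (n::int)) = of_int n * fst g"
proof -
  interpret group affine_group by (rule group_affine_group)
  have nat: "fst (g [^]\<^bsub>affine_group\<^esub> (m::nat)) = of_nat m * fst g" for m
    by (induction m) (auto simp: algebra_simps)
  have inv: "fst (inv\<^bsub>affine_group\<^esub> u) = - fst u" for u
  proof -
    have "fst (inv\<^bsub>affine_group\<^esub> u \<otimes>\<^bsub>affine_group\<^esub> u) = 0" by (subst l_inv) simp_all
    then show ?thesis unfolding fst_affine_mult by linarith
  qed
  show ?thesis
    by (cases "n < 0") (simp_all only: int_pow_def2 nat inv if_True if_False, simp_all)
qed

definition affine_stabilizer :: "real \<Rightarrow> (real \<times> real) set" where
  "affine_stabilizer p = {(l, b). exp l * p + b = p}"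

lemma subgroup_affineI:
  assumes "(0, 0) \<in> K"
    and "\<And>l b l' b'. (l, b) \<in> K \<Longrightarrow> (l', b') \<in> K \<Longrightarrow> (l + l', exp l * b' + b) \<in> K"
    and "\<And>l b. (l, b) \<in> K \<Longrightarrow> (- l, - exp (- l) * b) \<in> K"
  shows "subgroup K affine_group"
proof -
  interpret group affine_group by (rule group_affine_group)
  have "inv\<^bsub>affine_group\<^esub> (l, b) = (- l, - exp (- l) * b)" for l b
    by (rule inv_equality) auto
  then show ?thesis using assms by (intro subgroupI) auto
qed

lemma subgroup_affine_stabilizer: "subgroup (affine_stabilizer p) affine_group"
proof (rule subgroup_affineI)
  fix l b l' b' assume a: "(l, b) \<in> affine_stabilizer p" "(l', b') \<in> affine_stabilizer p"
  have "exp (l + l') * p + (exp l * b' + b) = exp l * (exp l' * p + b') + b"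
    by (simp add: exp_add algebra_simps)
  then show "(l + l', exp l * b' + b) \<in> affine_stabilizer p" using a by (simp add: affine_stabilizer_def)
next
  fix l b assume "(l, b) \<in> affine_stabilizer p"
  then have "exp (- l) * p = exp (- l) * (exp l * p + b)" by (simp add: affine_stabilizer_def)
  also have "\<dots> = p + exp (- l) * b" by (simp add: distrib_left mult.assoc[symmetric] exp_minus)
  finally show "(- l, - exp (- l) * b) \<in> affine_stabilizer p" by (simp add: affine_stabilizer_def)
qed (simp add: affine_stabilizer_def)

text \<open>
  From \<open>u g = g' u\<close> the map \<open>u\<close> sends fixed points of \<open>g\<close> to fixed points of \<open>g'\<close>. The two dilation
  factors agree and are nontrivial, so \<open>p\<close> is the only fixed point on either side.
\<close>

lemma affine_intertwiner_fixes:
  assumes "g \<in> affine_stabilizer p" "g' \<in> affine_stabilizer p" "fst g \<noteq> 0"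
    and eq: "u \<otimes>\<^bsub>affine_group\<^esub> g = g' \<otimes>\<^bsub>affine_group\<^esub> u"
  shows "u \<in> affine_stabilizer p"
proof -
  obtain a c l b l' b' where d: "u = (a, c)" "g = (l, b)" "g' = (l', b')" by (metis surj_pair)
  have l: "l' = l" and e: "exp a * b + c = exp l' * c + b'" using eq by (simp_all add: d)
  have b: "b = p - exp l * p" "b' = p - exp l * p"
    using assms(1,2) l by (simp_all add: d affine_stabilizer_def algebra_simps)
  have "(1 - exp l) * (exp a * p + c - p) = 0"
    using e unfolding b l by (simp add: algebra_simps)
  moreover have "1 - exp l \<noteq> 0" using assms(3) by (simp add: d)
  ultimately show ?thesis by (simp add: d affine_stabilizer_def)
qed

text \<open>
  Otherwise a power of \<open>2\<close> would equal a power of \<open>3\<close>, and parity would make both trivial.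
\<close>

lemma ln_2_ln_3_not_commensurable:
  assumes "ln 2 = of_int m * (r::real)" "ln 3 = of_int n * r"
  shows False
proof -
  have "of_int n * ln 2 = of_int m * (ln 3 :: real)" using assms by (simp add: mult.left_commute)
  from arg_cong[OF this, of abs] have "real_of_int \<bar>n\<bar> * ln 2 = of_int \<bar>m\<bar> * (ln 3 :: real)"
    by (simp add: abs_mult)
  then have "real (nat \<bar>n\<bar>) * ln 2 = real (nat \<bar>m\<bar>) * (ln 3 :: real)" by simp
  then have "ln ((2::real) ^ nat \<bar>n\<bar>) = ln (3 ^ nat \<bar>m\<bar>)" by (simp add: ln_realpow)
  then have "(2::real) ^ nat \<bar>n\<bar> = 3 ^ nat \<bar>m\<bar>" by (subst (asm) ln_inj_iff) auto
  then have "real (2 ^ nat \<bar>n\<bar>) = real (3 ^ nat \<bar>m\<bar>)" by simp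
  then have "(2::nat) ^ nat \<bar>n\<bar> = 3 ^ nat \<bar>m\<bar>" by (simp only: of_nat_eq_iff)
  then have "even ((2::nat) ^ nat \<bar>n\<bar>) \<longleftrightarrow> even ((3::nat) ^ nat \<bar>m\<bar>)" by simp
  then have "n = 0" by simp
  then show False using assms(2) by simp
qed

text \<open>
  Let the free group act on the line by \<open>s u = 2 u\<close> and \<open>t u = 3 u + 1\<close>. An epimorphism would make
  \<open>x\<close>, \<open>y\<close> and the stable letter generate this action. If \<open>x\<close> has a nontrivial dilation factor, it has
  a unique fixed point \<open>p\<close>, which \<open>y\<close> fixes too since it commutes with \<open>x\<close>. The stable letter conjugates
  \<open>x\<^sup>i\<close> to \<open>x\<^sup>j y\<^sup>k\<close>, and both fix only \<open>p\<close>, so it fixes \<open>p\<close> as well; but \<open>s\<close> and \<open>t\<close> have no common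
  fixed point. If \<open>x\<close> is a translation, so is \<open>y\<close>, by the same relation and \<open>k \<noteq> 0\<close>. Then every
  dilation factor is a power of that of the stable letter, but no number has both \<open>2\<close> and \<open>3\<close> among
  its integer powers.
\<close>

lemma loop_group_not_surjects_F2:
  assumes "i \<noteq> 0" "k \<noteq> 0"
  shows "\<not> surjects (loop_group i j k) F2"
proof
  let ?A = affine_group
  assume "surjects (loop_group i j k) F2"
  then obtain f where f: "f \<in> hom (loop_group i j k) F2" "f ` carrier (loop_group i j k) = carrier F2"
    by (auto simp: surjects_def epi_def)
  interpret A: group ?A by (rule group_affine_group)
  obtain \<rho> where \<rho>: "\<rho> \<in> hom F2 ?A" "\<rho> (F2gen True) = (ln 2, 0)" "\<rho> (F2gen False) = (ln 3, 1)"
    using F2_hom_exists[OF group_affine_group, of "(ln 2, 0)" "(ln 3, 1)"] by auto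
  define h where "h = \<rho> \<circ> f"
  have h: "h \<in> hom (loop_group i j k) ?A" unfolding h_def using f(1) \<rho>(1) by (rule hom_compose)
  define \<phi> where "\<phi> = h \<circ> pgen UNIV (loop_rels i j k)"
  have comm: "\<phi> Gen_x \<otimes>\<^bsub>?A\<^esub> \<phi> Gen_y = \<phi> Gen_y \<otimes>\<^bsub>?A\<^esub> \<phi> Gen_x"
    and conj: "\<phi> Gen_t \<otimes>\<^bsub>?A\<^esub> \<phi> Gen_x [^]\<^bsub>?A\<^esub> i
      = \<phi> Gen_x [^]\<^bsub>?A\<^esub> j \<otimes>\<^bsub>?A\<^esub> \<phi> Gen_y [^]\<^bsub>?A\<^esub> k \<otimes>\<^bsub>?A\<^esub> \<phi> Gen_t"
    using loop_group_hom_relations[OF group_affine_group h] by (auto simp: \<phi>_def)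
  have "\<exists>A\<in>carrier (loop_group i j k). f A = F2gen b" for b
    using f(2) F2gen_carrier[of b] by (metis (no_types, lifting) imageE)
  then have "\<exists>A\<in>carrier (loop_group i j k). h A = \<rho> (F2gen b)" for b
    by (metis comp_apply h_def)
  then have in_image: "\<rho> (F2gen b) \<in> K" if "subgroup K ?A" "\<And>a. \<phi> a \<in> K" for b K
    using hom_presented_group_in_subgroup[OF group_affine_group, of h UNIV "loop_rels i j k" K] h that
    by (metis \<phi>_def comp_apply loop_group_def)
  show False
  proof (cases "fst (\<phi> Gen_x) = 0")
    case True
    have "of_int k * fst (\<phi> Gen_y) = 0"
      using arg_cong[OF conj, of fst] True by (simp add: fst_affine_int_pow)
    then have y: "fst (\<phi> Gen_y) = 0" using assms by simp
    define r where "r = fst (\<phi> Gen_t)"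
    define K where "K = {g::real \<times> real. \<exists>n::int. fst g = of_int n * r}"
    have "subgroup K ?A"
    proof (rule subgroup_affineI)
      show "(l + l', exp l * b' + b) \<in> K" if "(l, b) \<in> K" "(l', b') \<in> K" for l b l' b'
        using that by (auto simp: K_def distrib_right[symmetric] of_int_add[symmetric] simp del: of_int_add)
      show "(- l, - exp (- l) * b) \<in> K" if "(l, b) \<in> K" for l b
        using that by (auto simp: K_def intro: exI[of _ "- _"])
    qed (auto simp: K_def intro: exI[of _ 0])
    moreover have "\<phi> a \<in> K" for a
      using True y by (cases a) (auto simp: K_def r_def intro: exI[of _ 0] exI[of _ 1])
    ultimately have "\<rho> (F2gen b) \<in> K" for b using in_image by blast
    from this[of True] this[of False] show False
      using ln_2_ln_3_not_commensurable by (auto simp: \<rho> K_def)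
  next
    case False
    define p where "p = snd (\<phi> Gen_x) / (1 - exp (fst (\<phi> Gen_x)))"
    note S = subgroup_affine_stabilizer[of p]
    have x: "\<phi> Gen_x \<in> affine_stabilizer p"
      using False
      by (cases "\<phi> Gen_x") (simp add: affine_stabilizer_def p_def divide_simps, simp add: algebra_simps)
    have y: "\<phi> Gen_y \<in> affine_stabilizer p"
      using affine_intertwiner_fixes[OF x x False] comm by simp
    have pow: "g [^]\<^bsub>?A\<^esub> n \<in> affine_stabilizer p" if "g \<in> affine_stabilizer p" for g and n :: int
      using A.subgroup_int_pow_closed[OF S that] .
    have t: "\<phi> Gen_t \<in> affine_stabilizer p"
      by (rule affine_intertwiner_fixes[OF pow[OF x] _ _ conj])
        (use False assms subgroup.m_closed[OF S pow[OF x] pow[OF y]] in \<open>simp_all add: fst_affine_int_pow\<close>)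
    have "\<phi> a \<in> affine_stabilizer p" for a using x y t by (cases a) auto
    then have "\<rho> (F2gen b) \<in> affine_stabilizer p" for b using in_image S by blast
    from this[of True] this[of False] show False by (simp add: \<rho> affine_stabilizer_def)
  qed
qed

section \<open>Subgroups of index two\<close>

text \<open>
  The wreath product of \<open>K\<close> with a group of order two; the last component of \<open>(a, b, p)\<close> tells whether
  the two coordinates of a right-hand factor are swapped before \<open>(a, b)\<close> multiplies them. A
  homomorphism from a subgroup of index two to \<open>K\<close> induces one from the whole group to this product.
\<close>

definition swap_wreath :: "('a, 'm) monoid_scheme \<Rightarrow> ('a \<times> 'a \<times> bool) monoid" where
  "swap_wreath K = \<lparr>carrier = carrier K \<times> carrier K \<times> UNIV,
     monoid.mult = (\<lambda>(a, b, p) (c, d, q).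
       (a \<otimes>\<^bsub>K\<^esub> (if p then d else c), b \<otimes>\<^bsub>K\<^esub> (if p then c else d), p \<noteq> q)),
     one = (\<one>\<^bsub>K\<^esub>, \<one>\<^bsub>K\<^esub>, False)\<rparr>"

lemma swap_wreath_simps [simp]:
  "carrier (swap_wreath K) = carrier K \<times> carrier K \<times> UNIV"
  "(a, b, p) \<otimes>\<^bsub>swap_wreath K\<^esub> (c, d, q)
    = (a \<otimes>\<^bsub>K\<^esub> (if p then d else c), b \<otimes>\<^bsub>K\<^esub> (if p then c else d), p \<noteq> q)"
  "\<one>\<^bsub>swap_wreath K\<^esub> = (\<one>\<^bsub>K\<^esub>, \<one>\<^bsub>K\<^esub>, False)"
  by (simp_all add: swap_wreath_def)

lemma group_swap_wreath:
  assumes "group K"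
  shows "group (swap_wreath K)"
proof -
  interpret K: group K by fact
  show ?thesis
  proof (rule groupI)
    fix g assume g: "g \<in> carrier (swap_wreath K)"
    obtain a b p where "g = (a, b, p)" by (metis surj_pair)
    then show "\<exists>y\<in>carrier (swap_wreath K). y \<otimes>\<^bsub>swap_wreath K\<^esub> g = \<one>\<^bsub>swap_wreath K\<^esub>"
      using g by (intro bexI[of _ "(inv\<^bsub>K\<^esub> (if p then b else a), inv\<^bsub>K\<^esub> (if p then a else b), p)"]) auto
  qed (auto simp: K.m_assoc)
qed

lemma swap_wreath_int_pow:
  assumes "group K" "a \<in> carrier K" "b \<in> carrier K"
  shows "(a, b, False) [^]\<^bsub>swap_wreath K\<^esub> (n::int) = (a [^]\<^bsub>K\<^esub> n, b [^]\<^bsub>K\<^esub> n, False)"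
proof -
  interpret K: group K by fact
  interpret W: group "swap_wreath K" using assms(1) by (rule group_swap_wreath)
  have nat: "(a, b, False) [^]\<^bsub>swap_wreath K\<^esub> (m::nat) = (a [^]\<^bsub>K\<^esub> m, b [^]\<^bsub>K\<^esub> m, False)" for m
    by (induction m) auto
  have inv: "inv\<^bsub>swap_wreath K\<^esub> (c, d, False) = (inv\<^bsub>K\<^esub> c, inv\<^bsub>K\<^esub> d, False)"
    if "c \<in> carrier K" "d \<in> carrier K" for c d
    using that by (intro W.inv_equality) auto
  show ?thesis
    by (cases "n < 0") (simp_all only: int_pow_def2 nat inv if_True if_False assms K.nat_pow_closed)
qed

text \<open>
  The elements without swap form the subgroup, and there the first coordinate is multiplicative, so
  that a homomorphism on the subgroup can be read off from one on the whole group.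
\<close>

lemma index_two_subgroup_of_swap_wreath_hom:
  assumes "group G" "group K" and \<Psi>: "\<Psi> \<in> hom G (swap_wreath K)"
    and g0: "g0 \<in> carrier G" "snd (snd (\<Psi> g0))"
  defines "H \<equiv> {g \<in> carrier G. \<not> snd (snd (\<Psi> g))}"
  shows "subgroup H G" "card (rcosets\<^bsub>G\<^esub> H) = 2" "(\<lambda>g. fst (\<Psi> g)) \<in> hom (G\<lparr>carrier := H\<rparr>) K"
proof -
  interpret K: group K by fact
  interpret W: group "swap_wreath K" using assms(2) by (rule group_swap_wreath)
  interpret group_hom G "swap_wreath K" \<Psi>
    using assms(1) \<Psi> W.group_axioms by (simp add: group_hom_def group_hom_axioms_def)
  have mult: "snd (snd (u \<otimes>\<^bsub>swap_wreath K\<^esub> v)) = (snd (snd u) \<noteq> snd (snd v))"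
    "\<not> snd (snd u) \<Longrightarrow> fst (u \<otimes>\<^bsub>swap_wreath K\<^esub> v) = fst u \<otimes>\<^bsub>K\<^esub> fst v" for u v
    by (cases u; cases v; simp)+
  have odd_mult: "snd (snd (\<Psi> (g \<otimes>\<^bsub>G\<^esub> h))) = (snd (snd (\<Psi> g)) \<noteq> snd (snd (\<Psi> h)))"
    if "g \<in> carrier G" "h \<in> carrier G" for g h
    using that by (simp add: mult)
  have odd_inv: "snd (snd (\<Psi> (inv\<^bsub>G\<^esub> g))) = snd (snd (\<Psi> g))" if "g \<in> carrier G" for g
    using odd_mult[of g "inv\<^bsub>G\<^esub> g"] that by simp
  show S: "subgroup H G"
    by (rule G.subgroupI) (auto simp: H_def odd_mult odd_inv simp del: hom_mult hom_inv intro!: exI[of _ "\<one>\<^bsub>G\<^esub>"])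
  have coset: "H #>\<^bsub>G\<^esub> a = {g \<in> carrier G. snd (snd (\<Psi> g)) = snd (snd (\<Psi> a))}"
    if a: "a \<in> carrier G" for a
  proof (intro equalityI subsetI)
    fix g assume g: "g \<in> {g \<in> carrier G. snd (snd (\<Psi> g)) = snd (snd (\<Psi> a))}"
    then have "g \<otimes>\<^bsub>G\<^esub> inv\<^bsub>G\<^esub> a \<in> H" using a by (auto simp: H_def odd_mult odd_inv simp del: hom_mult hom_inv)
    moreover have "g = g \<otimes>\<^bsub>G\<^esub> inv\<^bsub>G\<^esub> a \<otimes>\<^bsub>G\<^esub> a" using g a by (simp add: G.m_assoc)
    ultimately show "g \<in> H #>\<^bsub>G\<^esub> a" unfolding r_coset_def by blast
  qed (use a in \<open>auto simp: r_coset_def H_def odd_mult simp del: hom_mult hom_inv\<close>)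
  let ?C = "\<lambda>b. {g \<in> carrier G. snd (snd (\<Psi> g)) = b}"
  have "rcosets\<^bsub>G\<^esub> H = {?C False, ?C True}"
  proof -
    have "rcosets\<^bsub>G\<^esub> H = ?C ` (\<lambda>a. snd (snd (\<Psi> a))) ` carrier G"
      by (auto simp: RCOSETS_def coset)
    moreover have "(\<lambda>a. snd (snd (\<Psi> a))) ` carrier G = {False, True}"
      using g0 imageI[OF G.one_closed, of "\<lambda>a. snd (snd (\<Psi> a))"] by (auto intro: image_eqI[of _ _ g0])
    ultimately show ?thesis by simp
  qed
  moreover have "?C False \<noteq> ?C True" using g0 by blast
  ultimately show "card (rcosets\<^bsub>G\<^esub> H) = 2" unfolding card_2_iff by blast
  have "fst (\<Psi> g) \<in> carrier K" if "g \<in> carrier G" for g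
    using hom_closed[OF that] by (cases "\<Psi> g") auto
  then show "(\<lambda>g. fst (\<Psi> g)) \<in> hom (G\<lparr>carrier := H\<rparr>) K"
    by (auto intro!: homI simp: H_def mult)
qed

text \<open>
  The subgroup belongs to the double cover of the loop, a circle with two vertices. The two coordinates
  of the wreath product record what happens at these two vertices. Let \<open>x\<close>, \<open>y\<close> act at the first vertex
  by \<open>s\<^sup>a\<close>, \<open>s\<^sup>b\<close> and at the second by \<open>s\<^sup>c\<close>, \<open>s\<^sup>d\<close>, and let only one of the two edges carry the letter
  \<open>t\<close>. The edge without letter requires \<open>c i = a j + b k\<close>; across the other edge both sides have to
  vanish, that is, \<open>a i = 0\<close> and \<open>c j + d k = 0\<close>. A solution is \<open>a = 0\<close>, \<open>b = i\<close>, \<open>c = k\<close>, \<open>d = - j\<close>, and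
  dividing \<open>i\<close>, \<open>j\<close>, \<open>k\<close> by their greatest common divisor makes the exponents coprime.
\<close>

lemma virtually_surjects_F2_of_iso_loop_group:
  assumes "group G" "G \<cong> loop_group i j k" "i \<noteq> 0"
  shows "\<exists>H. subgroup H G \<and> card (rcosets\<^bsub>G\<^esub> H) = 2 \<and> surjects (G\<lparr>carrier := H\<rparr>) F2"
proof -
  let ?W = "swap_wreath F2" and ?s = "F2gen True" and ?t = "F2gen False"
  let ?L = "loop_group i j k"
  define gen where "gen = pgen UNIV (loop_rels i j k)"
  interpret F: group F2 by (rule group_F2)
  interpret W: group ?W by (rule group_swap_wreath[OF group_F2])
  interpret L: group ?L unfolding loop_group_def by (rule group_presented_group)
  have s: "?s \<in> carrier F2" "?t \<in> carrier F2" by simp_all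
  obtain d i' j' k' where d: "i = d * i'" "j = d * j'" "k = d * k'" "d \<noteq> 0"
    and gcd: "Gcd {i', j', k'} = 1"
    using triple_primitive_part[OF assms(3)] by metis
  define x where "x = (\<one>\<^bsub>F2\<^esub>, ?s [^]\<^bsub>F2\<^esub> k', False)"
  define y where "y = (?s [^]\<^bsub>F2\<^esub> i', ?s [^]\<^bsub>F2\<^esub> (- j'), False)"
  define t where "t = (\<one>\<^bsub>F2\<^esub>, ?t, True)"
  have pow: "?s [^]\<^bsub>F2\<^esub> (m::int) \<otimes>\<^bsub>F2\<^esub> ?s [^]\<^bsub>F2\<^esub> (n::int) = ?s [^]\<^bsub>F2\<^esub> (m + n)"
    "(?s [^]\<^bsub>F2\<^esub> m) [^]\<^bsub>F2\<^esub> n = ?s [^]\<^bsub>F2\<^esub> (m * n)" for m n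
    by (simp_all add: F.int_pow_mult F.int_pow_pow)
  have xy: "x \<otimes>\<^bsub>?W\<^esub> y = y \<otimes>\<^bsub>?W\<^esub> x" by (simp add: x_def y_def pow add.commute)
  have conj: "t \<otimes>\<^bsub>?W\<^esub> x [^]\<^bsub>?W\<^esub> i = x [^]\<^bsub>?W\<^esub> j \<otimes>\<^bsub>?W\<^esub> y [^]\<^bsub>?W\<^esub> k \<otimes>\<^bsub>?W\<^esub> t"
  proof -
    have "t \<otimes>\<^bsub>?W\<^esub> x [^]\<^bsub>?W\<^esub> i = (?s [^]\<^bsub>F2\<^esub> (k' * i), ?t, True)"
      by (simp add: x_def t_def swap_wreath_int_pow[OF group_F2] pow)
    moreover have "x [^]\<^bsub>?W\<^esub> j \<otimes>\<^bsub>?W\<^esub> y [^]\<^bsub>?W\<^esub> k \<otimes>\<^bsub>?W\<^esub> t =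
        (?s [^]\<^bsub>F2\<^esub> (i' * k), ?s [^]\<^bsub>F2\<^esub> (k' * j + - j' * k) \<otimes>\<^bsub>F2\<^esub> ?t, True)"
      by (simp add: x_def y_def t_def swap_wreath_int_pow[OF group_F2] pow)
    moreover have "k' * i = i' * k" "k' * j + - j' * k = 0" by (simp_all add: d)
    ultimately show ?thesis by simp
  qed
  obtain \<Phi> where \<Phi>: "\<Phi> \<in> hom ?L ?W" "\<Phi> (gen Gen_x) = x" "\<Phi> (gen Gen_y) = y" "\<Phi> (gen Gen_t) = t"
    unfolding gen_def
    by (rule loop_group_hom_exists[OF W.group_axioms _ _ _ xy conj]) (simp_all add: x_def y_def t_def)
  obtain \<theta> where \<theta>: "\<theta> \<in> iso G ?L" using assms(2) by (auto simp: is_iso_def)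
  define \<Psi> where "\<Psi> = \<Phi> \<circ> \<theta>"
  have \<Psi>: "\<Psi> \<in> hom G ?W" unfolding \<Psi>_def using \<theta> \<Phi>(1) by (intro hom_compose) (auto simp: iso_def)
  interpret group_hom G ?W \<Psi>
    using assms(1) \<Psi> W.group_axioms by (simp add: group_hom_def group_hom_axioms_def)
  have gen: "gen a \<in> carrier ?L" for a
    unfolding loop_group_def gen_def by (rule funcset_mem[OF pgen_in_carrier]) simp
  have "\<theta> ` carrier G = carrier ?L" using \<theta> by (simp add: iso_def bij_betw_def)
  then have "\<exists>g\<in>carrier G. \<theta> g = gen a" for a using gen by (metis imageE)
  then obtain gx gy gt where g: "gx \<in> carrier G" "\<theta> gx = gen Gen_x" "gy \<in> carrier G" "\<theta> gy = gen Gen_y"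
    "gt \<in> carrier G" "\<theta> gt = gen Gen_t" by metis
  have im: "\<Psi> gx = x" "\<Psi> gy = y" "\<Psi> gt = t" using g \<Phi> by (simp_all add: \<Psi>_def)
  define H where "H = {g \<in> carrier G. \<not> snd (snd (\<Psi> g))}"
  have "snd (snd (\<Psi> gt))" by (simp add: im t_def)
  note H = index_two_subgroup_of_swap_wreath_hom[OF assms(1) group_F2 \<Psi> g(5) this, folded H_def]
  have inv: "inv\<^bsub>?W\<^esub> t = (inv\<^bsub>F2\<^esub> ?t, \<one>\<^bsub>F2\<^esub>, True)" by (rule W.inv_equality) (simp_all add: t_def)
  \<comment> \<open>Elements of the subgroup: conjugation by \<open>gt\<close> brings second coordinates to the front.\<close>
  let ?c = "gt \<otimes>\<^bsub>G\<^esub> gx \<otimes>\<^bsub>G\<^esub> inv\<^bsub>G\<^esub> gt" and ?e = "gt \<otimes>\<^bsub>G\<^esub> gy \<otimes>\<^bsub>G\<^esub> inv\<^bsub>G\<^esub> gt"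
  have c: "?c \<in> H" "fst (\<Psi> ?c) = ?s [^]\<^bsub>F2\<^esub> k'"
    using g by (simp_all add: H_def im inv) (simp_all add: t_def x_def)
  have e: "?e \<in> H" "fst (\<Psi> ?e) = ?s [^]\<^bsub>F2\<^esub> (- j')"
    using g by (simp_all add: H_def im inv) (simp_all add: t_def y_def)
  have y: "gy \<in> H" "fst (\<Psi> gy) = ?s [^]\<^bsub>F2\<^esub> i'" using g by (simp_all add: H_def im y_def)
  have tt: "gt \<otimes>\<^bsub>G\<^esub> gt \<in> H" "fst (\<Psi> (gt \<otimes>\<^bsub>G\<^esub> gt)) = ?t" using g by (simp_all add: H_def im t_def)
  have "surjects (G\<lparr>carrier := H\<rparr>) F2"
  proof (rule surjects_F2_if_coprime_powers[OF _ H(3), of "\<lambda>b. if b then {i', - j', k'} else {1}"])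
    show "group (G\<lparr>carrier := H\<rparr>)" using H(1) by (rule G.subgroup_imp_group)
    show "Gcd (if b then {i', - j', k'} else {1}) = 1" for b using gcd by simp
    show "F2gen b [^]\<^bsub>F2\<^esub> n \<in> (\<lambda>g. fst (\<Psi> g)) ` carrier (G\<lparr>carrier := H\<rparr>)"
      if "n \<in> (if b then {i', - j', k'} else {1})" for b n
      using that y e c tt
      by (auto simp del: hom_mult intro: image_eqI[OF sym] split: if_splits)
  qed simp
  then show ?thesis using H by blast
qed

section \<open>Homomorphisms on the integers and on the integer lattice\<close>

lemma homs_eq_if_eq_on_cyclic_generator:
  assumes "\<psi> \<in> iso integer_group E" "group E" "group H" "f \<in> hom E H" "f' \<in> hom E H"
    and "f (\<psi> 1) = f' (\<psi> 1)" "c \<in> carrier E"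
  shows "f c = f' c"
proof -
  have "c \<in> \<psi> ` UNIV" using assms(1,7) by (auto simp: iso_def bij_betw_def)
  then obtain n where n: "c = \<psi> n" by blast
  have \<psi>: "\<psi> \<in> hom integer_group E" using assms(1) by (simp add: iso_def)
  have c: "\<psi> 1 \<in> carrier E" using hom_in_carrier[OF \<psi>] by simp
  have "c = \<psi> 1 [^]\<^bsub>E\<^esub> n"
    using hom_int_pow[OF \<psi>, of 1 n] assms(2) by (simp add: n)
  then show ?thesis
    using hom_int_pow[OF assms(4) c, of n] hom_int_pow[OF assms(5) c, of n] assms by simp
qed

text \<open>
  With \<open>z = d (p', q')\<close> and \<open>u p' + v q' = 1\<close>, the row \<open>(u, v)\<close> completes to an integer matrix of
  determinant \<open>1\<close> that sends \<open>z\<close> to \<open>(d, 0)\<close>.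
\<close>

lemma Z2_iso_onto_axis:
  assumes "z \<noteq> (0, 0)"
  obtains \<theta> d where "\<theta> \<in> iso Z2 Z2" "\<theta> z = (d, 0)" "d \<noteq> 0"
proof -
  obtain p q where z: "z = (p, q)" by fastforce
  define d where "d = gcd p q"
  have d: "d \<noteq> 0" using assms by (simp add: d_def z)
  obtain p' q' where pq: "p = d * p'" "q = d * q'" unfolding d_def by (meson dvdE gcd_dvd1 gcd_dvd2)
  obtain u v where "u * p + v * q = d" using bezout_int unfolding d_def by blast
  then have "d * (u * p' + v * q') = d * 1" by (simp add: pq algebra_simps)
  then have uv: "u * p' + v * q' = 1" using d by simp
  define \<theta> where "\<theta> = (\<lambda>(m, n). (u * m + v * n, p' * n - q' * m))"
  define \<eta> where "\<eta> = (\<lambda>(a, b). (p' * a - v * b, q' * a + u * b))"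
  have "\<eta> (\<theta> (m, n)) = (m, n)" for m n
  proof -
    have "\<eta> (\<theta> (m, n)) = ((u * p' + v * q') * m, (u * p' + v * q') * n)"
      unfolding \<theta>_def \<eta>_def by (simp add: algebra_simps)
    then show ?thesis by (simp add: uv)
  qed
  moreover have "\<theta> (\<eta> (m, n)) = (m, n)" for m n
  proof -
    have "\<theta> (\<eta> (m, n)) = ((u * p' + v * q') * m, (u * p' + v * q') * n)"
      unfolding \<theta>_def \<eta>_def by (simp add: algebra_simps)
    then show ?thesis by (simp add: uv)
  qed
  ultimately have "bij \<theta>" by (intro bij_betw_byWitness[of _ \<eta>]) auto
  moreover have "\<theta> \<in> hom Z2 Z2" by (auto intro!: homI simp: \<theta>_def algebra_simps)
  ultimately have "\<theta> \<in> iso Z2 Z2" by (simp add: iso_def)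
  moreover have "\<theta> z = (d * (u * p' + v * q'), 0)" by (simp add: z \<theta>_def pq algebra_simps)
  ultimately show thesis using that d by (simp add: uv)
qed

lemma group_Z2: "group Z2"
  by (simp add: DirProd_group)

lemma (in group) int_pow_commutes:
  assumes "a \<in> carrier G" "b \<in> carrier G" "a \<otimes> b = b \<otimes> a"
  shows "a [^] (n::int) \<otimes> b = b \<otimes> a [^] n"
proof -
  let ?C = "{g \<in> carrier G. g \<otimes> b = b \<otimes> g}"
  have "subgroup ?C G"
  proof (rule subgroupI)
    show "?C \<noteq> {}" using assms by auto
    show "inv g \<in> ?C" if g: "g \<in> ?C" for g
    proof -
      have c: "g \<in> carrier G" "g \<otimes> b = b \<otimes> g" using g by auto
      have "b \<otimes> inv g = inv g \<otimes> (g \<otimes> b) \<otimes> inv g" using c(1) assms(2) by (simp add: m_assoc[symmetric])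
      also have "\<dots> = inv g \<otimes> (b \<otimes> g) \<otimes> inv g" by (simp only: c(2))
      also have "\<dots> = inv g \<otimes> b" using c(1) assms(2) by (simp add: m_assoc)
      finally show ?thesis using c(1) by simp
    qed
    show "g \<otimes> h \<in> ?C" if "g \<in> ?C" "h \<in> ?C" for g h
    proof -
      have "g \<otimes> (h \<otimes> b) = b \<otimes> g \<otimes> h" using that assms(2) by (auto simp: m_assoc[symmetric])
      then show ?thesis using that assms(2) by (auto simp: m_assoc)
    qed
  qed auto
  then have "a [^] n \<in> ?C" using assms by (intro subgroup_int_pow_closed) auto
  then show ?thesis by simp
qed

lemma hom_from_Z2:
  assumes "group H" "x \<in> carrier H" "y \<in> carrier H" "x \<otimes>\<^bsub>H\<^esub> y = y \<otimes>\<^bsub>H\<^esub> x"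
  shows "(\<lambda>(m, n). x [^]\<^bsub>H\<^esub> (m::int) \<otimes>\<^bsub>H\<^esub> y [^]\<^bsub>H\<^esub> (n::int)) \<in> hom Z2 H"
proof (rule homI)
  interpret H: group H by fact
  let ?f = "\<lambda>(m, n). x [^]\<^bsub>H\<^esub> (m::int) \<otimes>\<^bsub>H\<^esub> y [^]\<^bsub>H\<^esub> (n::int)"
  show "?f z \<in> carrier H" for z using assms by (cases z) auto
  fix z z' :: "int \<times> int"
  obtain m n m' n' where z: "z = (m, n)" "z' = (m', n')" by fastforce
  have comm: "y [^]\<^bsub>H\<^esub> n \<otimes>\<^bsub>H\<^esub> x [^]\<^bsub>H\<^esub> m' = x [^]\<^bsub>H\<^esub> m' \<otimes>\<^bsub>H\<^esub> y [^]\<^bsub>H\<^esub> n"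
  proof -
    have "y [^]\<^bsub>H\<^esub> n \<otimes>\<^bsub>H\<^esub> x = x \<otimes>\<^bsub>H\<^esub> y [^]\<^bsub>H\<^esub> n"
      using assms H.int_pow_commutes by simp
    then show ?thesis using assms H.int_pow_commutes[of x "y [^]\<^bsub>H\<^esub> n" m'] by simp
  qed
  have "y [^]\<^bsub>H\<^esub> n \<otimes>\<^bsub>H\<^esub> (x [^]\<^bsub>H\<^esub> m' \<otimes>\<^bsub>H\<^esub> y [^]\<^bsub>H\<^esub> n')
      = x [^]\<^bsub>H\<^esub> m' \<otimes>\<^bsub>H\<^esub> (y [^]\<^bsub>H\<^esub> n \<otimes>\<^bsub>H\<^esub> y [^]\<^bsub>H\<^esub> n')"
    using assms comm by (simp add: H.m_assoc[symmetric])
  then show "?f (z \<otimes>\<^bsub>Z2\<^esub> z') = ?f z \<otimes>\<^bsub>H\<^esub> ?f z'"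
    using assms by (simp add: z H.int_pow_mult H.m_assoc)
qed

section \<open>Fundamental groups of tubular graphs of groups\<close>

locale tubular_group = tubular_graph_of_groups \<Gamma> VG EG tail_map head_map
  for \<Gamma> :: "('v, 'e) pre_digraph" and VG :: "'v \<Rightarrow> 'g monoid" and EG :: "'e \<Rightarrow> 'h monoid"
    and tail_map head_map :: "'e \<Rightarrow> 'h \<Rightarrow> 'g" +
  fixes T :: "('v, 'e) pre_digraph"
  assumes spanning_tree: "undirected_spanning_tree T \<Gamma>"
begin

definition gens :: "('v \<times> 'g + 'e) set" where
  "gens = (SIGMA v:verts \<Gamma>. carrier (VG v)) <+> arcs \<Gamma>"

definition rels :: "(('v \<times> 'g + 'e) gword \<times> ('v \<times> 'g + 'e) gword) set" where
  "rels =
     {([(Inl (v, g), True), (Inl (v, h), True)], [(Inl (v, g \<otimes>\<^bsub>VG v\<^esub> h), True)]) | v g h.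
         v \<in> verts \<Gamma> \<and> g \<in> carrier (VG v) \<and> h \<in> carrier (VG v)}
      \<union> {([(Inr e, True), (Inl (head \<Gamma> e, head_map e c), True), (Inr e, False)],
           [(Inl (tail \<Gamma> e, tail_map e c), True)]) | e c. e \<in> arcs \<Gamma> \<and> c \<in> carrier (EG e)}
      \<union> {([(Inr e, True)], []) | e. e \<in> arcs T}"

definition \<pi> :: "('v \<times> 'g + 'e) gword set monoid" where
  "\<pi> = presented_group gens rels"

definition vertex_elt :: "'v \<Rightarrow> 'g \<Rightarrow> ('v \<times> 'g + 'e) gword set" where
  "vertex_elt v g = pgen gens rels (Inl (v, g))"

definition edge_elt :: "'e \<Rightarrow> ('v \<times> 'g + 'e) gword set" where
  "edge_elt e = pgen gens rels (Inr e)"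

lemma fundamental_group_eq: "fundamental_group \<Gamma> VG EG tail_map head_map T = \<pi>"
  by (simp add: fundamental_group_def \<pi>_def gens_def rels_def)

lemma group_\<pi>: "group \<pi>"
  unfolding \<pi>_def by (rule group_presented_group)

lemma gens_iff [simp]:
  "Inl (v, g) \<in> gens \<longleftrightarrow> v \<in> verts \<Gamma> \<and> g \<in> carrier (VG v)"
  "Inr e \<in> gens \<longleftrightarrow> e \<in> arcs \<Gamma>"
  by (auto simp: gens_def)

lemma tree_arcs: "arcs T \<subseteq> arcs \<Gamma>" and tree_verts: "verts T = verts \<Gamma>"
  using spanning_tree by (auto simp: undirected_spanning_tree_def spanning_def subgraph_def)

lemma card_tree_arcs: "card (arcs T) < card (verts \<Gamma>)"
proof -
  have "wf_digraph T" "verts T \<noteq> {}" "\<nexists>p. undirected_cycle T p"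
    using spanning_tree
    by (auto simp: undirected_spanning_tree_def spanning_def subgraph_def connected_def
        strongly_connected_def)
  then show ?thesis
    using forest_card_arcs_less[of T] finite_verts finite_arcs tree_arcs tree_verts
    by (auto dest: finite_subset)
qed

lemma vertex_elt_closed: "v \<in> verts \<Gamma> \<Longrightarrow> g \<in> carrier (VG v) \<Longrightarrow> vertex_elt v g \<in> carrier \<pi>"
  unfolding vertex_elt_def \<pi>_def by (rule funcset_mem[OF pgen_in_carrier]) simp

lemma edge_elt_closed: "e \<in> arcs \<Gamma> \<Longrightarrow> edge_elt e \<in> carrier \<pi>"
  unfolding edge_elt_def \<pi>_def by (rule funcset_mem[OF pgen_in_carrier]) simp

lemma vertex_elt_hom:
  assumes v: "v \<in> verts \<Gamma>"
  shows "vertex_elt v \<in> hom (VG v) \<pi>"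
proof (rule homI)
  interpret V: group "VG v" using v by (rule vertex_group)
  interpret P: group \<pi> by (rule group_\<pi>)
  show "vertex_elt v g \<in> carrier \<pi>" if "g \<in> carrier (VG v)" for g
    using v that by (rule vertex_elt_closed)
  fix g h assume g: "g \<in> carrier (VG v)" "h \<in> carrier (VG v)"
  have "([(Inl (v, g), True), (Inl (v, h), True)], [(Inl (v, g \<otimes>\<^bsub>VG v\<^esub> h), True)]) \<in> rels"
    using v g unfolding rels_def by blast
  from word_eval_pgen_rel[OF this, of gens] v g
  show "vertex_elt v (g \<otimes>\<^bsub>VG v\<^esub> h) = vertex_elt v g \<otimes>\<^bsub>\<pi>\<^esub> vertex_elt v h"
    using vertex_elt_closed[OF v] by (simp flip: vertex_elt_def \<pi>_def)
qed

lemma edge_elt_conj: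
  assumes e: "e \<in> arcs \<Gamma>" and c: "c \<in> carrier (EG e)"
  shows "edge_elt e \<otimes>\<^bsub>\<pi>\<^esub> vertex_elt (head \<Gamma> e) (head_map e c)
    = vertex_elt (tail \<Gamma> e) (tail_map e c) \<otimes>\<^bsub>\<pi>\<^esub> edge_elt e"
proof -
  interpret P: group \<pi> by (rule group_\<pi>)
  have t: "tail \<Gamma> e \<in> verts \<Gamma>" "tail_map e c \<in> carrier (VG (tail \<Gamma> e))"
    and h: "head \<Gamma> e \<in> verts \<Gamma>" "head_map e c \<in> carrier (VG (head \<Gamma> e))"
    using e c tail_mon[OF e] head_mon[OF e] by (auto simp: mon_def hom_def)
  have "([(Inr e, True), (Inl (head \<Gamma> e, head_map e c), True), (Inr e, False)],
      [(Inl (tail \<Gamma> e, tail_map e c), True)]) \<in> rels"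
    using e c unfolding rels_def by blast
  from word_eval_pgen_rel[OF this, of gens] e t h
  have "edge_elt e \<otimes>\<^bsub>\<pi>\<^esub> (vertex_elt (head \<Gamma> e) (head_map e c) \<otimes>\<^bsub>\<pi>\<^esub> inv\<^bsub>\<pi>\<^esub> edge_elt e)
      = vertex_elt (tail \<Gamma> e) (tail_map e c)"
    using vertex_elt_closed edge_elt_closed by (simp flip: vertex_elt_def edge_elt_def \<pi>_def)
  then show ?thesis
    using e t h vertex_elt_closed edge_elt_closed
    by (metis P.inv_closed P.inv_solve_right' P.m_assoc P.m_closed)
qed

text \<open>
  The universal property, applied to the three kinds of relators. In inverse-free form an edge relator
  says that the image of the stable letter intertwines the homomorphisms on the adjacent vertex groups.
\<close>

lemma hom_exists:
  assumes H: "group H" and \<alpha>: "\<And>v. v \<in> verts \<Gamma> \<Longrightarrow> \<alpha> v \<in> hom (VG v) H"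
    and \<tau>: "\<And>e. e \<in> arcs \<Gamma> \<Longrightarrow> \<tau> e \<in> carrier H" "\<And>e. e \<in> arcs T \<Longrightarrow> \<tau> e = \<one>\<^bsub>H\<^esub>"
    and conj: "\<And>e c. e \<in> arcs \<Gamma> \<Longrightarrow> c \<in> carrier (EG e) \<Longrightarrow>
      \<tau> e \<otimes>\<^bsub>H\<^esub> \<alpha> (head \<Gamma> e) (head_map e c) = \<alpha> (tail \<Gamma> e) (tail_map e c) \<otimes>\<^bsub>H\<^esub> \<tau> e"
  obtains h where "h \<in> hom \<pi> H"
    "\<And>v g. v \<in> verts \<Gamma> \<Longrightarrow> g \<in> carrier (VG v) \<Longrightarrow> h (vertex_elt v g) = \<alpha> v g"
    "\<And>e. e \<in> arcs \<Gamma> \<Longrightarrow> h (edge_elt e) = \<tau> e"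
proof -
  interpret H: group H by fact
  define \<phi> where "\<phi> = case_sum (\<lambda>(v, g). \<alpha> v g) \<tau>"
  have \<phi>_simps [simp]: "\<phi> (Inl (v, g)) = \<alpha> v g" "\<phi> (Inr e) = \<tau> e" for v g e by (simp_all add: \<phi>_def)
  have \<alpha>_closed: "\<alpha> v g \<in> carrier H" if "v \<in> verts \<Gamma>" "g \<in> carrier (VG v)" for v g
    using hom_in_carrier[OF \<alpha>[OF that(1)] that(2)] .
  have \<phi>: "\<phi> \<in> gens \<rightarrow> carrier H"
    using \<tau>(1) \<alpha>_closed by (auto simp: gens_def)
  have rels: "word_eval H \<phi> r = word_eval H \<phi> s" if "(r, s) \<in> rels" for r s
  proof -
    have "(\<exists>v g h. r = [(Inl (v, g), True), (Inl (v, h), True)] \<and> s = [(Inl (v, g \<otimes>\<^bsub>VG v\<^esub> h), True)] \<and>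
          v \<in> verts \<Gamma> \<and> g \<in> carrier (VG v) \<and> h \<in> carrier (VG v))
      \<or> (\<exists>e c. r = [(Inr e, True), (Inl (head \<Gamma> e, head_map e c), True), (Inr e, False)] \<and>
          s = [(Inl (tail \<Gamma> e, tail_map e c), True)] \<and> e \<in> arcs \<Gamma> \<and> c \<in> carrier (EG e))
      \<or> (\<exists>e. r = [(Inr e, True)] \<and> s = [] \<and> e \<in> arcs T)"
      using that unfolding rels_def by auto
    then show ?thesis
    proof (elim disjE exE conjE)
      fix v g h assume *: "r = [(Inl (v, g), True), (Inl (v, h), True)]" "s = [(Inl (v, g \<otimes>\<^bsub>VG v\<^esub> h), True)]"
        "v \<in> verts \<Gamma>" "g \<in> carrier (VG v)" "h \<in> carrier (VG v)"
      interpret V: group "VG v" using *(3) by (rule vertex_group)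
      show ?thesis using * \<alpha>_closed hom_mult[OF \<alpha>[OF *(3)] *(4,5)] by simp
    next
      fix e c assume *: "r = [(Inr e, True), (Inl (head \<Gamma> e, head_map e c), True), (Inr e, False)]"
        "s = [(Inl (tail \<Gamma> e, tail_map e c), True)]" "e \<in> arcs \<Gamma>" "c \<in> carrier (EG e)"
      have cl: "\<alpha> (tail \<Gamma> e) (tail_map e c) \<in> carrier H" "\<alpha> (head \<Gamma> e) (head_map e c) \<in> carrier H"
        using * tail_mon[OF *(3)] head_mon[OF *(3)] by (auto simp: mon_def hom_def intro!: \<alpha>_closed)
      have "\<tau> e \<otimes>\<^bsub>H\<^esub> \<alpha> (head \<Gamma> e) (head_map e c) \<otimes>\<^bsub>H\<^esub> inv\<^bsub>H\<^esub> \<tau> e = \<alpha> (tail \<Gamma> e) (tail_map e c)"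
        using conj[OF *(3,4)] cl \<tau>(1)[OF *(3)] by (simp add: H.m_assoc)
      then show ?thesis using * cl \<tau>(1)[OF *(3)] by (simp add: H.m_assoc)
    next
      fix e assume *: "r = [(Inr e, True)]" "s = []" "e \<in> arcs T"
      then show ?thesis using \<tau>(2) by simp
    qed
  qed
  have "\<exists>h\<in>hom \<pi> H. \<forall>w\<in>gwords gens. h (pres_rel gens rels `` {w}) = word_eval H \<phi> w"
    unfolding \<pi>_def by (rule presented_group_hom_exists[OF H \<phi> rels])
  then obtain h where h: "h \<in> hom \<pi> H"
    "\<forall>w\<in>gwords gens. h (pres_rel gens rels `` {w}) = word_eval H \<phi> w" by (rule bexE)
  have gen: "h (pgen gens rels a) = \<phi> a" if "a \<in> gens" for a
    using bspec[OF h(2), of "[(a, True)]"] that funcset_mem[OF \<phi> that] by simp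
  show thesis
    by (rule that[OF h(1)]) (simp_all add: vertex_elt_def edge_elt_def gen)
qed

lemma endo_eq_id:
  assumes h: "h \<in> hom \<pi> \<pi>"
    and "\<And>v g. v \<in> verts \<Gamma> \<Longrightarrow> g \<in> carrier (VG v) \<Longrightarrow> h (vertex_elt v g) = vertex_elt v g"
    and "\<And>e. e \<in> arcs \<Gamma> \<Longrightarrow> h (edge_elt e) = edge_elt e"
    and A: "A \<in> carrier \<pi>"
  shows "h A = A"
proof (rule presented_group_endo_eq_id[OF h[unfolded \<pi>_def] _ A[unfolded \<pi>_def]])
  fix a assume "a \<in> gens"
  then show "h (pgen gens rels a) = pgen gens rels a"
    using assms(2,3) by (auto simp: gens_def vertex_elt_def edge_elt_def)
qed

subsection \<open>Coordinates on vertex and edge groups\<close>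

text \<open>
  Coordinates and generators are chosen once and for all: a condition on an edge group then becomes
  a single linear equation about the two images of its generator.
\<close>

definition coord :: "'v \<Rightarrow> 'g \<Rightarrow> int \<times> int" where
  "coord v = (SOME \<phi>. \<phi> \<in> iso (VG v) Z2)"

definition edge_gen :: "'e \<Rightarrow> 'h" where
  "edge_gen e = (SOME \<psi>. \<psi> \<in> iso integer_group (EG e)) 1"

lemma coord_iso: "v \<in> verts \<Gamma> \<Longrightarrow> coord v \<in> iso (VG v) Z2"
  using vertex_group_iso unfolding coord_def is_iso_def some_in_eq .

lemma edge_iso:
  assumes "e \<in> arcs \<Gamma>"
  obtains \<psi> where "\<psi> \<in> iso integer_group (EG e)" "edge_gen e = \<psi> 1"
proof -
  have "integer_group \<cong> EG e"
    using group.iso_sym[OF edge_group[OF assms] edge_group_iso[OF assms]] .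
  then have "(SOME \<psi>. \<psi> \<in> iso integer_group (EG e)) \<in> iso integer_group (EG e)"
    unfolding is_iso_def some_in_eq .
  then show thesis by (rule that) (simp add: edge_gen_def)
qed

lemma edge_gen_closed: "e \<in> arcs \<Gamma> \<Longrightarrow> edge_gen e \<in> carrier (EG e)"
  by (rule edge_iso[of e]) (auto simp: iso_def hom_def)

lemma edge_gen_neq_one: "e \<in> arcs \<Gamma> \<Longrightarrow> edge_gen e \<noteq> \<one>\<^bsub>EG e\<^esub>"
proof (rule edge_iso, assumption)
  fix \<psi> assume e: "e \<in> arcs \<Gamma>" and \<psi>: "\<psi> \<in> iso integer_group (EG e)" "edge_gen e = \<psi> 1"
  have "\<psi> 0 = \<one>\<^bsub>EG e\<^esub>"
    using hom_one[of \<psi> integer_group "EG e"] \<psi>(1) edge_group[OF e] by (simp add: iso_def)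
  moreover have "inj \<psi>" using \<psi>(1) by (simp add: iso_def bij_betw_def)
  ultimately show "edge_gen e \<noteq> \<one>\<^bsub>EG e\<^esub>" using \<psi>(2) by (metis inj_eq zero_neq_one)
qed

lemma edge_homs_eq:
  assumes "e \<in> arcs \<Gamma>" "group H" "f \<in> hom (EG e) H" "f' \<in> hom (EG e) H"
    and "f (edge_gen e) = f' (edge_gen e)" "c \<in> carrier (EG e)"
  shows "f c = f' c"
  using edge_iso[OF assms(1)] assms(5)
    homs_eq_if_eq_on_cyclic_generator[OF _ edge_group[OF assms(1)] assms(2-4) _ assms(6)]
  by metis

lemma tail_map_hom: "e \<in> arcs \<Gamma> \<Longrightarrow> tail_map e \<in> hom (EG e) (VG (tail \<Gamma> e))"
  and head_map_hom: "e \<in> arcs \<Gamma> \<Longrightarrow> head_map e \<in> hom (EG e) (VG (head \<Gamma> e))"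
  using tail_mon head_mon by (auto simp: mon_def)

lemma edge_maps_gen_neq_one:
  assumes e: "e \<in> arcs \<Gamma>"
  shows "tail_map e (edge_gen e) \<noteq> \<one>\<^bsub>VG (tail \<Gamma> e)\<^esub>" "head_map e (edge_gen e) \<noteq> \<one>\<^bsub>VG (head \<Gamma> e)\<^esub>"
proof -
  interpret E: group "EG e" using e by (rule edge_group)
  have "tail_map e \<one>\<^bsub>EG e\<^esub> = \<one>\<^bsub>VG (tail \<Gamma> e)\<^esub>" "head_map e \<one>\<^bsub>EG e\<^esub> = \<one>\<^bsub>VG (head \<Gamma> e)\<^esub>"
    using e tail_map_hom head_map_hom edge_group vertex_group by (auto intro!: hom_one)
  moreover have "inj_on (tail_map e) (carrier (EG e))" "inj_on (head_map e) (carrier (EG e))"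
    using tail_mon[OF e] head_mon[OF e] by (auto simp: mon_def)
  ultimately show "tail_map e (edge_gen e) \<noteq> \<one>\<^bsub>VG (tail \<Gamma> e)\<^esub>" "head_map e (edge_gen e) \<noteq> \<one>\<^bsub>VG (head \<Gamma> e)\<^esub>"
    using edge_gen_neq_one[OF e] edge_gen_closed[OF e] E.one_closed by (metis inj_onD)+
qed

text \<open>
  The linear form with coefficients \<open>x True\<close>, \<open>x False\<close> in the chosen coordinates. The coefficients are
  indexed by \<open>bool\<close> so that they can serve as the unknowns of a linear system.
\<close>

definition functional :: "'v \<Rightarrow> (bool \<Rightarrow> int) \<Rightarrow> 'g \<Rightarrow> int" where
  "functional v x g = (\<Sum>b\<in>UNIV. (if b then fst (coord v g) else snd (coord v g)) * x b)"

lemma functional_hom: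
  assumes v: "v \<in> verts \<Gamma>"
  shows "functional v x \<in> hom (VG v) integer_group"
proof (rule homI)
  fix g h assume g: "g \<in> carrier (VG v)" "h \<in> carrier (VG v)"
  have "coord v \<in> hom (VG v) Z2" using coord_iso[OF v] by (simp add: iso_def)
  from hom_mult[OF this g]
  show "functional v x (g \<otimes>\<^bsub>VG v\<^esub> h) = functional v x g \<otimes>\<^bsub>integer_group\<^esub> functional v x h"
    by (cases "coord v g"; cases "coord v h") (simp add: functional_def UNIV_bool algebra_simps)
qed simp

lemma functional_attains_coefficients:
  assumes v: "v \<in> verts \<Gamma>"
  shows "\<exists>g\<in>carrier (VG v). functional v x g = x b"
proof -
  have "coord v ` carrier (VG v) = UNIV" using coord_iso[OF v] by (simp add: iso_def bij_betw_def)
  then obtain g where "g \<in> carrier (VG v)" "coord v g = (if b then (1, 0) else (0, 1))"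
    by (metis UNIV_I imageE)
  then show ?thesis by (intro bexI[of _ g]) (cases b; simp add: functional_def UNIV_bool)+
qed

lemma functional_power_hom:
  "v \<in> verts \<Gamma> \<Longrightarrow> (\<lambda>g. F2gen b [^]\<^bsub>F2\<^esub> functional v x g) \<in> hom (VG v) F2"
  using hom_compose[OF functional_hom group.hom_integer_group_pow[OF group_F2 F2gen_carrier]]
  by (simp add: comp_def)

end

section \<open>Graphs with more than one vertex or loop\<close>

context tubular_group
begin

text \<open>
  Killing all vertex groups leaves the fundamental group of the graph, which is free on the arcs off
  the tree.
\<close>

lemma surjects_F2_if_two_arcs_off_tree:
  assumes e: "e1 \<in> arcs \<Gamma> - arcs T" "e2 \<in> arcs \<Gamma> - arcs T" "e1 \<noteq> e2"
  shows "surjects \<pi> F2"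
proof -
  interpret F: group F2 by (rule group_F2)
  let ?\<tau> = "\<lambda>e. if e = e1 then F2gen True else if e = e2 then F2gen False else \<one>\<^bsub>F2\<^esub>"
  obtain h where h: "h \<in> hom \<pi> F2" "\<And>e. e \<in> arcs \<Gamma> \<Longrightarrow> h (edge_elt e) = ?\<tau> e"
    by (rule hom_exists[OF group_F2, of "\<lambda>v g. \<one>\<^bsub>F2\<^esub>" ?\<tau>]) (use e in \<open>auto simp: hom_def\<close>)
  show ?thesis
  proof (rule hom_onto_F2I[OF group_\<pi> h(1)])
    show "F2gen True \<in> h ` carrier \<pi>"
      using h(2)[of e1] edge_elt_closed[of e1] e by (auto intro: image_eqI[OF sym])
    show "F2gen False \<in> h ` carrier \<pi>"
      using h(2)[of e2] edge_elt_closed[of e2] e by (auto intro: image_eqI[OF sym])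
  qed
qed

lemma functional_tail_map_hom:
  "e \<in> arcs \<Gamma> \<Longrightarrow> (\<lambda>c. functional (tail \<Gamma> e) x (tail_map e c)) \<in> hom (EG e) integer_group"
  and functional_head_map_hom:
  "e \<in> arcs \<Gamma> \<Longrightarrow> (\<lambda>c. functional (head \<Gamma> e) x (head_map e c)) \<in> hom (EG e) integer_group"
  using hom_compose[OF tail_map_hom functional_hom] hom_compose[OF head_map_hom functional_hom]
  by (simp_all add: comp_def)

lemma zero_hom: "e \<in> arcs \<Gamma> \<Longrightarrow> (\<lambda>c. 0) \<in> hom (EG e) integer_group"
  by (simp add: hom_def)

text \<open>
  The stable letter of the arc \<open>e0\<close> off the tree goes to \<open>t\<close>, and a linear form maps each vertex group
  to the powers of \<open>s\<close>. Since \<open>s\<close> and \<open>t\<close> satisfy no relation, both images of the edge group of \<open>e0\<close>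
  have to vanish; across a tree arc the forms only have to agree. These are two equations more than
  the tree has arcs, hence at most \<open>|V| + 1\<close>, in \<open>2 |V|\<close> coefficients, and \<open>|V| + 1 < 2 |V|\<close> for
  \<open>|V| \<ge> 2\<close>.
\<close>

lemma surjects_F2_if_one_arc_off_tree:
  assumes e0: "arcs \<Gamma> - arcs T = {e0}" and two: "2 \<le> card (verts \<Gamma>)"
  shows "surjects \<pi> F2"
proof -
  interpret F: group F2 by (rule group_F2)
  let ?I = "verts \<Gamma> \<times> (UNIV :: bool set)"
  let ?J = "arcs T <+> (UNIV :: bool set)"
  have e0': "e0 \<in> arcs \<Gamma>" "e0 \<notin> arcs T" using e0 by auto
  \<comment> \<open>Row of the system that evaluates, at \<open>g\<close>, the unknown form on the vertex group of \<open>w\<close>.\<close>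
  define row where "row w g i = (if fst i = w then if snd i then fst (coord w g) else snd (coord w g) else 0)"
    for w :: 'v and g and i :: "'v \<times> bool"
  have row: "(\<Sum>i\<in>?I. row w g i * x i) = functional w (\<lambda>b. x (w, b)) g" if w: "w \<in> verts \<Gamma>" for w g x
  proof -
    have "(\<Sum>i\<in>?I. row w g i * x i) = (\<Sum>v\<in>verts \<Gamma>. \<Sum>b\<in>UNIV. row w g (v, b) * x (v, b))"
      by (simp add: sum.cartesian_product case_prod_unfold)
    also have "\<dots> = (\<Sum>v\<in>verts \<Gamma>. if v = w then functional w (\<lambda>b. x (w, b)) g else 0)"
      by (rule sum.cong) (auto simp: row_def functional_def intro!: sum.cong)
    finally show ?thesis using w finite_verts by simp
  qed
  \<comment> \<open>The equation \<open>Inl e\<close> is agreement across the tree arc \<open>e\<close>; the two equations \<open>Inr b\<close> are vanishing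
     at the two ends of \<open>e0\<close>.\<close>
  define A where "A j = (case j of
      Inl e \<Rightarrow> (\<lambda>i. row (head \<Gamma> e) (head_map e (edge_gen e)) i - row (tail \<Gamma> e) (tail_map e (edge_gen e)) i)
    | Inr b \<Rightarrow> if b then row (head \<Gamma> e0) (head_map e0 (edge_gen e0))
        else row (tail \<Gamma> e0) (tail_map e0 (edge_gen e0)))" for j :: "'e + bool"
  have fin: "finite (arcs T)" using finite_arcs tree_arcs by (rule rev_finite_subset)
  have "card ?J = card (arcs T) + 2" using fin by (simp add: card_Plus)
  moreover have "card ?I = 2 * card (verts \<Gamma>)" by (simp add: card_cartesian_product)
  ultimately have "card ?J < card ?I" using card_tree_arcs two by linarith
  then obtain x where x: "Gcd (x ` ?I) = 1" "\<And>j. j \<in> ?J \<Longrightarrow> (\<Sum>i\<in>?I. A j i * x i) = 0"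
    using homogeneous_system_primitive_int_solution[of ?J ?I A] fin finite_verts by auto
  define f where "f v = functional v (\<lambda>b. x (v, b))" for v
  have tree: "f (head \<Gamma> e) (head_map e c) = f (tail \<Gamma> e) (tail_map e c)"
    if e: "e \<in> arcs T" and c: "c \<in> carrier (EG e)" for e c
  proof -
    have e': "e \<in> arcs \<Gamma>" using e tree_arcs by auto
    have "f (head \<Gamma> e) (head_map e (edge_gen e)) = f (tail \<Gamma> e) (tail_map e (edge_gen e))"
      using x(2)[OF InlI[OF e]] e' by (simp add: A_def left_diff_distrib sum_subtractf row f_def)
    then show ?thesis
      using edge_homs_eq[OF e' group_integer_group functional_head_map_hom[OF e'] functional_tail_map_hom[OF e'] _ c]
      unfolding f_def by blast
  qed
  have loop: "f (head \<Gamma> e0) (head_map e0 c) = 0" "f (tail \<Gamma> e0) (tail_map e0 c) = 0"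
    if c: "c \<in> carrier (EG e0)" for c
  proof -
    have "f (head \<Gamma> e0) (head_map e0 (edge_gen e0)) = 0" "f (tail \<Gamma> e0) (tail_map e0 (edge_gen e0)) = 0"
      using x(2)[OF InrI[OF UNIV_I], of True] x(2)[OF InrI[OF UNIV_I], of False] e0' by (simp_all add: A_def row f_def)
    then show "f (head \<Gamma> e0) (head_map e0 c) = 0" "f (tail \<Gamma> e0) (tail_map e0 c) = 0"
      using edge_homs_eq[OF e0'(1) group_integer_group functional_head_map_hom[OF e0'(1)] zero_hom[OF e0'(1)] _ c]
        edge_homs_eq[OF e0'(1) group_integer_group functional_tail_map_hom[OF e0'(1)] zero_hom[OF e0'(1)] _ c]
      unfolding f_def by blast+
  qed
  let ?\<alpha> = "\<lambda>v g. F2gen True [^]\<^bsub>F2\<^esub> f v g" and ?\<tau> = "\<lambda>e. if e = e0 then F2gen False else \<one>\<^bsub>F2\<^esub>"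
  have conj: "?\<tau> e \<otimes>\<^bsub>F2\<^esub> ?\<alpha> (head \<Gamma> e) (head_map e c) = ?\<alpha> (tail \<Gamma> e) (tail_map e c) \<otimes>\<^bsub>F2\<^esub> ?\<tau> e"
    if "e \<in> arcs \<Gamma>" "c \<in> carrier (EG e)" for e c
  proof (cases "e = e0")
    case True
    then show ?thesis using loop[of c] that by simp
  next
    case False
    then have "e \<in> arcs T" using that e0 by auto
    then show ?thesis using tree[of e c] that False by simp
  qed
  have \<alpha>: "?\<alpha> v \<in> hom (VG v) F2" if "v \<in> verts \<Gamma>" for v
    unfolding f_def using that by (rule functional_power_hom)
  obtain h where h: "h \<in> hom \<pi> F2"
    "\<And>v g. v \<in> verts \<Gamma> \<Longrightarrow> g \<in> carrier (VG v) \<Longrightarrow> h (vertex_elt v g) = ?\<alpha> v g"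
    "\<And>e. e \<in> arcs \<Gamma> \<Longrightarrow> h (edge_elt e) = ?\<tau> e"
    by (rule hom_exists[OF group_F2 \<alpha>, of ?\<tau>]) (use conj e0' in auto)
  show ?thesis
  proof (rule surjects_F2_if_coprime_powers[OF group_\<pi> h(1), of "\<lambda>b. if b then x ` ?I else {1}"])
    fix b n assume n: "n \<in> (if b then x ` ?I else {1})"
    show "F2gen b [^]\<^bsub>F2\<^esub> n \<in> h ` carrier \<pi>"
    proof (cases b)
      case True
      then obtain v b' where v: "v \<in> verts \<Gamma>" "n = x (v, b')" using n by auto
      obtain g where g: "g \<in> carrier (VG v)" "f v g = n"
        using functional_attains_coefficients[OF v(1), of "\<lambda>b. x (v, b)" b'] v(2) by (auto simp: f_def)
      have "h (vertex_elt v g) = F2gen b [^]\<^bsub>F2\<^esub> n" using h(2)[OF v(1) g(1)] g(2) True by simp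
      then show ?thesis using vertex_elt_closed[OF v(1) g(1)] by (metis imageI)
    next
      case False
      then have "h (edge_elt e0) = F2gen b [^]\<^bsub>F2\<^esub> n" using h(3)[OF e0'(1)] n by simp
      then show ?thesis using edge_elt_closed[OF e0'(1)] by (metis imageI)
    qed
  qed (use x(1) finite_verts in auto)
qed

text \<open>
  A loop contributes twice, as for undirected graphs.
\<close>

definition degree :: "'v \<Rightarrow> nat" where
  "degree v = card {e \<in> arcs \<Gamma>. tail \<Gamma> e = v} + card {e \<in> arcs \<Gamma>. head \<Gamma> e = v}"

lemma sum_degree: "(\<Sum>v\<in>verts \<Gamma>. degree v) = 2 * card (arcs \<Gamma>)"
proof -
  have "(\<Sum>v\<in>verts \<Gamma>. card {e \<in> arcs \<Gamma>. g e = v}) = card (arcs \<Gamma>)"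
    if "g ` arcs \<Gamma> \<subseteq> verts \<Gamma>" for g
    using sum.group[OF finite_arcs finite_verts that, of "\<lambda>_. 1 :: nat"] by simp
  moreover have "tail \<Gamma> ` arcs \<Gamma> \<subseteq> verts \<Gamma>" "head \<Gamma> ` arcs \<Gamma> \<subseteq> verts \<Gamma>" by auto
  ultimately show ?thesis by (simp add: degree_def sum.distrib)
qed

lemma degree_pos:
  assumes v: "v \<in> verts \<Gamma>" and two: "2 \<le> card (verts \<Gamma>)"
  shows "0 < degree v"
proof -
  have "verts \<Gamma> \<noteq> {v}" using two by auto
  then obtain w where w: "w \<in> verts \<Gamma>" "w \<noteq> v" using v by blast
  have "v \<rightarrow>\<^sup>*\<^bsub>with_proj (mk_symmetric \<Gamma>)\<^esub> w"
    using connected_graph v w by (auto simp: connected_def strongly_connected_def)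
  then obtain u where "(v, u) \<in> arcs_ends (with_proj (mk_symmetric \<Gamma>))"
    using w(2) by (auto elim: pre_digraph.converse_reachable_cases)
  then have "\<exists>e\<in>arcs \<Gamma>. tail \<Gamma> e = v \<or> head \<Gamma> e = v"
    by (auto simp: mk_symmetric_def arcs_ends_def arc_to_ends_def)
  then show ?thesis using finite_arcs by (auto simp: degree_def card_gt_0_iff)
qed

text \<open>
  At most one edge group is attached to a leaf, which is a single linear condition on two coefficients.
\<close>

lemma leaf_functional:
  assumes v: "v \<in> verts \<Gamma>" and leaf: "degree v < 2"
  obtains x where "Gcd (range x) = 1"
    "\<And>e c. e \<in> arcs \<Gamma> \<Longrightarrow> tail \<Gamma> e = v \<Longrightarrow> c \<in> carrier (EG e) \<Longrightarrow> functional v x (tail_map e c) = 0"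
    "\<And>e c. e \<in> arcs \<Gamma> \<Longrightarrow> head \<Gamma> e = v \<Longrightarrow> c \<in> carrier (EG e) \<Longrightarrow> functional v x (head_map e c) = 0"
proof -
  let ?J = "{e \<in> arcs \<Gamma>. tail \<Gamma> e = v} <+> {e \<in> arcs \<Gamma>. head \<Gamma> e = v}"
  let ?A = "\<lambda>j b. let z = coord v (case j of Inl e \<Rightarrow> tail_map e (edge_gen e) | Inr e \<Rightarrow> head_map e (edge_gen e))
    in if b then fst z else snd z"
  have "card ?J < card (UNIV :: bool set)" using leaf finite_arcs by (simp add: degree_def card_Plus)
  then obtain x where x: "Gcd (range x) = 1" "\<And>j. j \<in> ?J \<Longrightarrow> (\<Sum>b\<in>UNIV. ?A j b * x b) = 0"
    using homogeneous_system_primitive_int_solution[of ?J "UNIV :: bool set" ?A] finite_arcs by auto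
  show thesis
  proof (rule that[OF x(1)])
    fix e c assume e: "e \<in> arcs \<Gamma>" "tail \<Gamma> e = v" and c: "c \<in> carrier (EG e)"
    have "functional v x (tail_map e (edge_gen e)) = 0"
      using x(2)[OF InlI, of e] e by (simp add: functional_def Let_def)
    then show "functional v x (tail_map e c) = 0"
      using edge_homs_eq[OF e(1) group_integer_group functional_tail_map_hom[OF e(1)] zero_hom[OF e(1)] _ c]
      unfolding e(2) by blast
  next
    fix e c assume e: "e \<in> arcs \<Gamma>" "head \<Gamma> e = v" and c: "c \<in> carrier (EG e)"
    have "functional v x (head_map e (edge_gen e)) = 0"
      using x(2)[OF InrI, of e] e by (simp add: functional_def Let_def)
    then show "functional v x (head_map e c) = 0"
      using edge_homs_eq[OF e(1) group_integer_group functional_head_map_hom[OF e(1)] zero_hom[OF e(1)] _ c]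
      unfolding e(2) by blast
  qed
qed

text \<open>
  The degrees are positive and add up to \<open>2 |E| \<le> 2 |V| - 2\<close>, so at least two vertices have degree \<open>1\<close>.
  Kill all other vertex groups, and map the groups of two leaves onto the powers of \<open>s\<close> and of \<open>t\<close> by
  forms that vanish on the attached edge groups.
\<close>

lemma surjects_F2_if_tree:
  assumes tree: "arcs \<Gamma> = arcs T" and two: "2 \<le> card (verts \<Gamma>)"
  shows "surjects \<pi> F2"
proof -
  interpret F: group F2 by (rule group_F2)
  let ?L = "{v \<in> verts \<Gamma>. degree v < 2}"
  have "2 \<le> card ?L"
  proof -
    have "(\<Sum>v\<in>verts \<Gamma>. 2) \<le> (\<Sum>v\<in>verts \<Gamma>. degree v + (if degree v < 2 then 1 else 0))"
      using degree_pos two by (intro sum_mono) (simp, fastforce)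
    also have "\<dots> = 2 * card (arcs \<Gamma>) + card ?L"
      using finite_verts by (simp add: sum.distrib sum_degree sum.If_cases Int_def)
    finally show ?thesis using card_tree_arcs tree by simp
  qed
  then obtain S where "S \<subseteq> ?L" "card S = 2" by (rule obtain_subset_with_card_n)
  then obtain v w where vw: "v \<in> ?L" "w \<in> ?L" "v \<noteq> w" unfolding card_2_iff by blast
  obtain x where x: "Gcd (range x) = 1"
      "\<And>e c. e \<in> arcs \<Gamma> \<Longrightarrow> tail \<Gamma> e = v \<Longrightarrow> c \<in> carrier (EG e) \<Longrightarrow> functional v x (tail_map e c) = 0"
      "\<And>e c. e \<in> arcs \<Gamma> \<Longrightarrow> head \<Gamma> e = v \<Longrightarrow> c \<in> carrier (EG e) \<Longrightarrow> functional v x (head_map e c) = 0"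
    by (rule leaf_functional[of v]) (use vw in blast)+
  obtain y where y: "Gcd (range y) = 1"
      "\<And>e c. e \<in> arcs \<Gamma> \<Longrightarrow> tail \<Gamma> e = w \<Longrightarrow> c \<in> carrier (EG e) \<Longrightarrow> functional w y (tail_map e c) = 0"
      "\<And>e c. e \<in> arcs \<Gamma> \<Longrightarrow> head \<Gamma> e = w \<Longrightarrow> c \<in> carrier (EG e) \<Longrightarrow> functional w y (head_map e c) = 0"
    by (rule leaf_functional[of w]) (use vw in blast)+
  define \<alpha> where "\<alpha> u g = (if u = v then F2gen True [^]\<^bsub>F2\<^esub> functional v x g
    else if u = w then F2gen False [^]\<^bsub>F2\<^esub> functional w y g else \<one>\<^bsub>F2\<^esub>)" for u g
  have \<alpha>: "\<alpha> u \<in> hom (VG u) F2" if "u \<in> verts \<Gamma>" for u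
  proof -
    have "(\<lambda>g. \<one>\<^bsub>F2\<^esub>) \<in> hom (VG u) F2" by (simp add: hom_def)
    then show ?thesis using functional_power_hom[OF that]
      by (cases "u = v"; cases "u = w") (simp_all add: \<alpha>_def[abs_def])
  qed
  have ends: "\<alpha> (tail \<Gamma> e) (tail_map e c) = \<one>\<^bsub>F2\<^esub>" "\<alpha> (head \<Gamma> e) (head_map e c) = \<one>\<^bsub>F2\<^esub>"
    if "e \<in> arcs \<Gamma>" "c \<in> carrier (EG e)" for e c
    using x(2,3)[of e c] y(2,3)[of e c] that by (auto simp: \<alpha>_def)
  obtain h where h: "h \<in> hom \<pi> F2"
    "\<And>u g. u \<in> verts \<Gamma> \<Longrightarrow> g \<in> carrier (VG u) \<Longrightarrow> h (vertex_elt u g) = \<alpha> u g"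
    by (rule hom_exists[OF group_F2 \<alpha>, of "\<lambda>_. \<one>\<^bsub>F2\<^esub>"]) (simp_all add: ends)
  show ?thesis
  proof (rule surjects_F2_if_coprime_powers[OF group_\<pi> h(1), of "\<lambda>b. range (if b then x else y)"])
    fix b n assume n: "n \<in> range (if b then x else y)"
    define u where "u = (if b then v else w)"
    have u: "u \<in> verts \<Gamma>" using vw by (simp add: u_def)
    obtain b' where "n = (if b then x else y) b'" using n by blast
    then obtain g where g: "g \<in> carrier (VG u)" "functional u (if b then x else y) g = n"
      using functional_attains_coefficients[OF u] by metis
    have "h (vertex_elt u g) = F2gen b [^]\<^bsub>F2\<^esub> n"
      using h(2)[OF u g(1)] g(2) vw(3) by (auto simp: \<alpha>_def u_def split: if_splits)
    then show "F2gen b [^]\<^bsub>F2\<^esub> n \<in> h ` carrier \<pi>" using vertex_elt_closed[OF u g(1)] by (metis imageI)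
  qed (use x(1) y(1) in auto)
qed

lemma single_vertex_arcs_tree:
  assumes "verts \<Gamma> = {v}"
  shows "arcs T = {}"
  using card_tree_arcs assms finite_arcs tree_arcs by (auto dest: finite_subset)

lemma surjects_F2_if_not_small:
  assumes "\<not> single_vertex \<Gamma>" "\<not> single_self_loop \<Gamma>"
  shows "surjects \<pi> F2"
proof (cases "\<exists>e1 e2. e1 \<in> arcs \<Gamma> - arcs T \<and> e2 \<in> arcs \<Gamma> - arcs T \<and> e1 \<noteq> e2")
  case True
  then show ?thesis using surjects_F2_if_two_arcs_off_tree by blast
next
  case False
  have two: "2 \<le> card (verts \<Gamma>)"
  proof (rule ccontr)
    assume "\<not> 2 \<le> card (verts \<Gamma>)"
    then have "card (verts \<Gamma>) = 1" using card_tree_arcs by linarith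
    then obtain v where v: "verts \<Gamma> = {v}" by (rule card_1_singletonE)
    have T: "arcs T = {}" using v by (rule single_vertex_arcs_tree)
    have "arcs \<Gamma> \<noteq> {}" using assms(1) v by (auto simp: single_vertex_def)
    then obtain e where e: "arcs \<Gamma> = {e}" using False T by blast
    then have "tail \<Gamma> e = v" "head \<Gamma> e = v" using tail_in_verts head_in_verts v by blast+
    then show False using assms(2) v e by (auto simp: single_self_loop_def)
  qed
  show ?thesis
  proof (cases "arcs \<Gamma> - arcs T = {}")
    case True
    then have "arcs \<Gamma> = arcs T" using tree_arcs by blast
    then show ?thesis using two by (rule surjects_F2_if_tree)
  next
    case no: False
    then obtain e0 where "arcs \<Gamma> - arcs T = {e0}" using False by blast
    then show ?thesis using two by (rule surjects_F2_if_one_arc_off_tree)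
  qed
qed

section \<open>Graphs with a single vertex\<close>

lemma iso_Z2_if_single_vertex:
  assumes "single_vertex \<Gamma>"
  shows "\<pi> \<cong> Z2"
proof -
  obtain v where v: "verts \<Gamma> = {v}" and no_arcs: "arcs \<Gamma> = {}" using assms by (auto simp: single_vertex_def)
  have v': "v \<in> verts \<Gamma>" by (simp add: v)
  have V: "group (VG v)" using v' by (rule vertex_group)
  have T: "arcs T = {}" using tree_arcs no_arcs by blast
  obtain h where h: "h \<in> hom \<pi> (VG v)"
    "\<And>u g. u \<in> verts \<Gamma> \<Longrightarrow> g \<in> carrier (VG u) \<Longrightarrow> h (vertex_elt u g) = g"
    by (rule hom_exists[OF V, of "\<lambda>u g. g" "\<lambda>_. \<one>\<^bsub>VG v\<^esub>"]) (auto simp: v no_arcs T hom_def)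
  note \<iota> = vertex_elt_hom[OF v']
  have "vertex_elt v (h A) = A" if A: "A \<in> carrier \<pi>" for A
    using endo_eq_id[OF hom_compose[OF h(1) \<iota>] _ _ A] h(2) by (simp add: v no_arcs)
  then have "\<pi> \<cong> VG v"
    by (rule is_iso_if_homs_mutually_inverse[OF h(1) \<iota>]) (use h(2)[OF v'] in auto)
  then show ?thesis using vertex_group_iso[OF v'] by (rule iso_trans)
qed

text \<open>
  Take coordinates on the vertex group in which the image of the edge group at the head lies on the
  first axis, generated by \<open>(d, 0)\<close>; the image at the tail is generated by some \<open>(j, k)\<close>. Both are
  nonzero because the edge maps are injective. The single arc is not in the tree, which has fewer arcs
  than vertices, so its stable letter survives. Matching \<open>x\<close>, \<open>y\<close> with the two unit vectors and stable
  letter with stable letter gives mutually inverse homomorphisms.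
\<close>

lemma iso_loop_group_if_single_self_loop:
  assumes "single_self_loop \<Gamma>"
  shows "\<exists>i j k. i \<noteq> 0 \<and> \<not> (j = 0 \<and> k = 0) \<and> \<pi> \<cong> loop_group i j k"
proof -
  obtain v e where v: "verts \<Gamma> = {v}" and e: "arcs \<Gamma> = {e}" "tail \<Gamma> e = v" "head \<Gamma> e = v"
    using assms by (auto simp: single_self_loop_def)
  have v': "v \<in> verts \<Gamma>" and e': "e \<in> arcs \<Gamma>" by (simp_all add: v e)
  interpret V: group "VG v" using v' by (rule vertex_group)
  interpret P: group \<pi> by (rule group_\<pi>)
  have T: "arcs T = {}" using v by (rule single_vertex_arcs_tree)
  define a where "a = head_map e (edge_gen e)"
  define b where "b = tail_map e (edge_gen e)"
  have ab: "a \<in> carrier (VG v)" "b \<in> carrier (VG v)" "a \<noteq> \<one>\<^bsub>VG v\<^esub>" "b \<noteq> \<one>\<^bsub>VG v\<^esub>"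
    using hom_in_carrier[OF head_map_hom[OF e'] edge_gen_closed[OF e']]
      hom_in_carrier[OF tail_map_hom[OF e'] edge_gen_closed[OF e']] edge_maps_gen_neq_one[OF e']
    by (simp_all add: a_def b_def e)
  have nonzero: "\<phi> g \<noteq> (0, 0)" if "\<phi> \<in> iso (VG v) Z2" "g \<in> carrier (VG v)" "g \<noteq> \<one>\<^bsub>VG v\<^esub>" for \<phi> g
  proof -
    have "\<phi> \<one>\<^bsub>VG v\<^esub> = (0, 0)" using hom_one[of \<phi> "VG v" Z2] that(1) V.group_axioms group_Z2 by (simp add: iso_def)
    moreover have "inj_on \<phi> (carrier (VG v))" using that(1) by (simp add: iso_def bij_betw_def)
    ultimately show ?thesis using that(2,3) V.one_closed by (metis inj_on_eq_iff)
  qed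
  obtain \<theta>0 d where \<theta>0: "\<theta>0 \<in> iso Z2 Z2" "\<theta>0 (coord v a) = (d, 0)" "d \<noteq> 0"
    using Z2_iso_onto_axis[OF nonzero[OF coord_iso[OF v'] ab(1,3)]] by blast
  define \<theta> where "\<theta> = \<theta>0 \<circ> coord v"
  have \<theta>: "\<theta> \<in> iso (VG v) Z2" unfolding \<theta>_def using coord_iso[OF v'] \<theta>0(1) by (rule iso_set_trans)
  have \<theta>_hom: "\<theta> \<in> hom (VG v) Z2" using \<theta> by (simp add: iso_def)
  have \<theta>a: "\<theta> a = (d, 0)" by (simp add: \<theta>_def \<theta>0)
  obtain j k where \<theta>b: "\<theta> b = (j, k)" by fastforce
  have jk: "\<not> (j = 0 \<and> k = 0)" using nonzero[OF \<theta> ab(2,4)] \<theta>b by simp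
  let ?L = "loop_group d j k"
  define gen where "gen = pgen UNIV (loop_rels d j k)"
  interpret L: group ?L unfolding loop_group_def by (rule group_presented_group)
  have gen: "gen c \<in> carrier ?L" for c
    unfolding loop_group_def gen_def by (rule funcset_mem[OF pgen_in_carrier]) simp
  have "(\<lambda>A. A) \<in> hom ?L ?L" by (simp add: hom_def)
  note L_rels = loop_group_hom_relations[OF L.group_axioms this, folded gen_def, unfolded comp_def]
  define \<beta> where "\<beta> = (\<lambda>(m, n). gen Gen_x [^]\<^bsub>?L\<^esub> (m::int) \<otimes>\<^bsub>?L\<^esub> gen Gen_y [^]\<^bsub>?L\<^esub> (n::int))"
  have \<beta>: "\<beta> \<in> hom Z2 ?L"
    unfolding \<beta>_def using L_rels gen by (intro hom_from_Z2[OF L.group_axioms]) auto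
  define \<alpha> where "\<alpha> = (\<lambda>u::'v. \<beta> \<circ> \<theta>)"
  have \<alpha>: "\<alpha> u \<in> hom (VG u) ?L" if "u \<in> verts \<Gamma>" for u
    using that hom_compose[OF \<theta>_hom \<beta>] by (simp add: \<alpha>_def v)
  have conj: "gen Gen_t \<otimes>\<^bsub>?L\<^esub> \<alpha> (head \<Gamma> e) (head_map e c) = \<alpha> (tail \<Gamma> e) (tail_map e c) \<otimes>\<^bsub>?L\<^esub> gen Gen_t"
    if c: "c \<in> carrier (EG e)" for c
  proof -
    \<comment> \<open>Both sides are homomorphisms of the cyclic edge group, so the relation for its generator suffices.\<close>
    let ?f = "\<lambda>c. gen Gen_t \<otimes>\<^bsub>?L\<^esub> \<alpha> v (head_map e c) \<otimes>\<^bsub>?L\<^esub> inv\<^bsub>?L\<^esub> gen Gen_t"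
    let ?f' = "\<lambda>c. \<alpha> v (tail_map e c)"
    have hd: "(\<lambda>c. \<alpha> v (head_map e c)) \<in> hom (EG e) ?L" and tl: "?f' \<in> hom (EG e) ?L"
      using hom_compose[OF head_map_hom[OF e'] \<alpha>] hom_compose[OF tail_map_hom[OF e'] \<alpha>]
      by (simp_all add: comp_def e v)
    have cl: "\<alpha> v (head_map e c) \<in> carrier ?L" "\<alpha> v (tail_map e c) \<in> carrier ?L" if "c \<in> carrier (EG e)" for c
      using hom_in_carrier[OF hd that] hom_in_carrier[OF tl that] by auto
    have "?f \<in> hom (EG e) ?L"
    proof (rule homI)
      fix c c' assume c: "c \<in> carrier (EG e)" "c' \<in> carrier (EG e)"
      have "inv\<^bsub>?L\<^esub> gen Gen_t \<otimes>\<^bsub>?L\<^esub> (gen Gen_t \<otimes>\<^bsub>?L\<^esub> z) = z" if "z \<in> carrier ?L" for z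
        using that gen by (simp add: L.m_assoc[symmetric])
      then show "?f (c \<otimes>\<^bsub>EG e\<^esub> c') = ?f c \<otimes>\<^bsub>?L\<^esub> ?f c'"
        using cl c gen hom_mult[OF hd c] by (simp add: L.m_assoc)
    qed (use cl gen in auto)
    moreover have "?f (edge_gen e) = ?f' (edge_gen e)"
    proof -
      have "\<alpha> v a = gen Gen_x [^]\<^bsub>?L\<^esub> d" "\<alpha> v b = gen Gen_x [^]\<^bsub>?L\<^esub> j \<otimes>\<^bsub>?L\<^esub> gen Gen_y [^]\<^bsub>?L\<^esub> k"
        using gen by (simp_all add: \<alpha>_def \<beta>_def \<theta>a \<theta>b)
      then show ?thesis using L_rels(3) gen by (simp add: L.m_assoc flip: a_def b_def)
    qed
    ultimately have "?f c = ?f' c" using edge_homs_eq[OF e' L.group_axioms _ tl _ c] by blast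
    then have "?f c \<otimes>\<^bsub>?L\<^esub> gen Gen_t = ?f' c \<otimes>\<^bsub>?L\<^esub> gen Gen_t" by simp
    then show ?thesis using cl[OF c] gen by (simp add: e L.m_assoc)
  qed
  obtain h where h: "h \<in> hom \<pi> ?L"
    "\<And>u g. u \<in> verts \<Gamma> \<Longrightarrow> g \<in> carrier (VG u) \<Longrightarrow> h (vertex_elt u g) = \<alpha> u g"
    "\<And>e. e \<in> arcs \<Gamma> \<Longrightarrow> h (edge_elt e) = gen Gen_t"
    by (rule hom_exists[OF L.group_axioms \<alpha>, of "\<lambda>_. gen Gen_t"]) (use gen conj T e in auto)
  define \<eta> where "\<eta> = inv_into (carrier (VG v)) \<theta>"
  have \<eta>: "\<eta> z \<in> carrier (VG v)" "\<theta> (\<eta> z) = z" for z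
    using \<theta> by (auto simp: \<eta>_def iso_def bij_betw_def intro: inv_into_into f_inv_into_f)
  have \<theta>_inj: "g = g'" if "\<theta> g = \<theta> g'" "g \<in> carrier (VG v)" "g' \<in> carrier (VG v)" for g g'
    using \<theta> that by (auto simp: iso_def bij_betw_def dest: inj_onD)
  define x where "x = \<eta> (1, 0)"
  define y where "y = \<eta> (0, 1)"
  have xy: "x \<in> carrier (VG v)" "y \<in> carrier (VG v)" by (simp_all add: x_def y_def \<eta>)
  have \<theta>_pow: "\<theta> (x [^]\<^bsub>VG v\<^esub> (m::int) \<otimes>\<^bsub>VG v\<^esub> y [^]\<^bsub>VG v\<^esub> (n::int)) = (m, n)" for m n
  proof -
    have fst: "fst \<circ> \<theta> \<in> hom (VG v) integer_group" and snd: "snd \<circ> \<theta> \<in> hom (VG v) integer_group"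
      using \<theta>_hom by (auto simp: hom_def mult_DirProd')
    have "fst (\<theta> (g [^]\<^bsub>VG v\<^esub> n)) = n * fst (\<theta> g)" "snd (\<theta> (g [^]\<^bsub>VG v\<^esub> n)) = n * snd (\<theta> g)"
      if "g \<in> carrier (VG v)" for g and n :: int
      using hom_int_pow[OF fst that V.group_axioms group_integer_group, of n]
        hom_int_pow[OF snd that V.group_axioms group_integer_group, of n] by simp_all
    then have pow: "\<theta> (g [^]\<^bsub>VG v\<^esub> n) = (n * fst (\<theta> g), n * snd (\<theta> g))"
      if "g \<in> carrier (VG v)" for g and n :: int using that by (simp add: prod_eq_iff)
    show ?thesis using xy \<theta>_hom by (simp add: hom_mult pow x_def y_def \<eta>)
  qed
  have decomp: "g = x [^]\<^bsub>VG v\<^esub> fst (\<theta> g) \<otimes>\<^bsub>VG v\<^esub> y [^]\<^bsub>VG v\<^esub> snd (\<theta> g)" if "g \<in> carrier (VG v)" for g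
    using that xy by (intro \<theta>_inj) (simp_all add: \<theta>_pow)
  note \<iota> = vertex_elt_hom[OF v']
  have \<iota>_pow: "vertex_elt v (x [^]\<^bsub>VG v\<^esub> (m::int) \<otimes>\<^bsub>VG v\<^esub> y [^]\<^bsub>VG v\<^esub> (n::int))
      = vertex_elt v x [^]\<^bsub>\<pi>\<^esub> m \<otimes>\<^bsub>\<pi>\<^esub> vertex_elt v y [^]\<^bsub>\<pi>\<^esub> n" for m n
    using xy by (simp add: hom_mult[OF \<iota>] hom_int_pow[OF \<iota> _ V.group_axioms P.group_axioms])
  have comm: "vertex_elt v x \<otimes>\<^bsub>\<pi>\<^esub> vertex_elt v y = vertex_elt v y \<otimes>\<^bsub>\<pi>\<^esub> vertex_elt v x"
  proof -
    have "x \<otimes>\<^bsub>VG v\<^esub> y = y \<otimes>\<^bsub>VG v\<^esub> x"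
      using xy by (intro \<theta>_inj) (simp_all add: hom_mult[OF \<theta>_hom] x_def y_def \<eta>)
    then show ?thesis using xy hom_mult[OF \<iota>] by metis
  qed
  have rel: "edge_elt e \<otimes>\<^bsub>\<pi>\<^esub> vertex_elt v x [^]\<^bsub>\<pi>\<^esub> d
      = vertex_elt v x [^]\<^bsub>\<pi>\<^esub> j \<otimes>\<^bsub>\<pi>\<^esub> vertex_elt v y [^]\<^bsub>\<pi>\<^esub> k \<otimes>\<^bsub>\<pi>\<^esub> edge_elt e"
  proof -
    have cl: "vertex_elt v x \<in> carrier \<pi>" "vertex_elt v y \<in> carrier \<pi>"
      using vertex_elt_closed[OF v'] xy by auto
    have "vertex_elt v a = vertex_elt v x [^]\<^bsub>\<pi>\<^esub> d"
      using decomp[OF ab(1)] \<iota>_pow[of d 0] cl by (simp add: \<theta>a)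
    moreover have "vertex_elt v b = vertex_elt v x [^]\<^bsub>\<pi>\<^esub> j \<otimes>\<^bsub>\<pi>\<^esub> vertex_elt v y [^]\<^bsub>\<pi>\<^esub> k"
      using decomp[OF ab(2)] \<iota>_pow[of j k] by (simp add: \<theta>b)
    ultimately show ?thesis
      using edge_elt_conj[OF e' edge_gen_closed[OF e']] by (simp add: e flip: a_def b_def)
  qed
  obtain g where g: "g \<in> hom ?L \<pi>" "g (gen Gen_x) = vertex_elt v x" "g (gen Gen_y) = vertex_elt v y"
    "g (gen Gen_t) = edge_elt e"
    unfolding gen_def
    by (rule loop_group_hom_exists[OF P.group_axioms _ _ _ comm rel])
      (use vertex_elt_closed[OF v'] xy edge_elt_closed[OF e'] in auto)
  have "g (h A) = A" if A: "A \<in> carrier \<pi>" for A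
  proof -
    have "(g \<circ> h) A = A"
    proof (rule endo_eq_id[OF hom_compose[OF h(1) g(1)] _ _ A])
      fix u r assume u: "u \<in> verts \<Gamma>" and r: "r \<in> carrier (VG u)"
      have uv: "u = v" using u v by simp
      have "g (\<beta> (m, n)) = vertex_elt v (x [^]\<^bsub>VG v\<^esub> m \<otimes>\<^bsub>VG v\<^esub> y [^]\<^bsub>VG v\<^esub> n)" for m n
        using gen by (simp add: \<beta>_def hom_mult[OF g(1)] hom_int_pow[OF g(1) _ L.group_axioms P.group_axioms] g \<iota>_pow)
      then have "g (\<beta> (\<theta> r)) = vertex_elt v r"
        using decomp[of r] r uv by (metis prod.collapse)
      then show "(g \<circ> h) (vertex_elt u r) = vertex_elt u r" using h(2)[OF u r] uv by (simp add: \<alpha>_def)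
    next
      fix e' assume "e' \<in> arcs \<Gamma>"
      then show "(g \<circ> h) (edge_elt e') = edge_elt e'" using h(3) g(4) e by simp
    qed
    then show ?thesis by simp
  qed
  moreover have "h (g B) = B" if B: "B \<in> carrier ?L" for B
  proof -
    have "h (vertex_elt v x) = gen Gen_x" "h (vertex_elt v y) = gen Gen_y"
      using h(2)[OF v'] xy gen by (simp_all add: \<alpha>_def \<beta>_def x_def y_def \<eta>)
    then have "(h \<circ> g) (gen c) = gen c" for c using g h(3)[OF e'] by (cases c) auto
    then have "(h \<circ> g) B = B"
      using presented_group_endo_eq_id[of "h \<circ> g" UNIV "loop_rels d j k" B] hom_compose[OF g(1) h(1)] B
      unfolding gen_def loop_group_def by blast
    then show ?thesis by simp
  qed
  ultimately have "\<pi> \<cong> ?L" using is_iso_if_homs_mutually_inverse[OF h(1) g(1)] by blast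
  then show ?thesis using \<theta>0(3) jk by blast
qed

end

theorem proposition4p1:
  fixes \<Gamma> Tr :: "('v, 'e) pre_digraph"
    and VG :: "'v \<Rightarrow> 'g monoid" and EG :: "'e \<Rightarrow> 'h monoid"
    and tail_map head_map :: "'e \<Rightarrow> 'h \<Rightarrow> 'g"
    and G :: "('v \<times> 'g + 'e) gword set monoid"
  assumes tubular: "tubular_graph_of_groups \<Gamma> VG EG tail_map head_map"
    and tree: "undirected_spanning_tree Tr \<Gamma>"
    and G: "G = fundamental_group \<Gamma> VG EG tail_map head_map Tr"
  shows "(single_vertex \<Gamma> \<longrightarrow> G \<cong> Z2)
    \<and> (\<not> single_vertex \<Gamma> \<and> \<not> single_self_loop \<Gamma> \<longrightarrow> surjects G F2)
    \<and> (single_self_loop \<Gamma> \<longrightarrow>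
        (\<exists>i j k. i \<noteq> 0 \<and> \<not> (j = 0 \<and> k = 0) \<and> G \<cong> loop_group i j k)
        \<and> (\<forall>i j k. i \<noteq> 0 \<and> \<not> (j = 0 \<and> k = 0) \<and> G \<cong> loop_group i j k \<longrightarrow>
             (surjects G F2 \<longleftrightarrow> k = 0)
             \<and> (k \<noteq> 0 \<longrightarrow>
                  (\<exists>H. subgroup H G \<and> card (rcosets\<^bsub>G\<^esub> H) = 2
                     \<and> surjects (G\<lparr>carrier := H\<rparr>) F2))))"
proof -
  interpret tubular_group \<Gamma> VG EG tail_map head_map Tr
    using tubular tree by (simp add: tubular_group_def tubular_group_axioms_def)
  have G_eq: "G = \<pi>" unfolding G by (rule fundamental_group_eq)
  have group_G: "group G" unfolding G_eq by (rule group_\<pi>)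
  have loops: "(surjects G F2 \<longleftrightarrow> k = 0) \<and> (k \<noteq> 0 \<longrightarrow>
      (\<exists>H. subgroup H G \<and> card (rcosets\<^bsub>G\<^esub> H) = 2 \<and> surjects (G\<lparr>carrier := H\<rparr>) F2))"
    if "i \<noteq> 0" and iso: "G \<cong> loop_group i j k" for i j k
  proof -
    have "loop_group i j k \<cong> G" using group.iso_sym[OF group_G iso] .
    then have "surjects G F2 \<longleftrightarrow> surjects (loop_group i j k) F2" using surjects_iso iso by metis
    also have "\<dots> \<longleftrightarrow> k = 0"
      using loop_group_not_surjects_F2[OF that(1)] loop_group_surjects_F2 by (cases "k = 0") auto
    finally show ?thesis using virtually_surjects_F2_of_iso_loop_group[OF group_G iso that(1)] by simp
  qed
  have "single_vertex \<Gamma> \<longrightarrow> G \<cong> Z2" unfolding G_eq using iso_Z2_if_single_vertex by simp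
  moreover have "\<not> single_vertex \<Gamma> \<and> \<not> single_self_loop \<Gamma> \<longrightarrow> surjects G F2"
    unfolding G_eq using surjects_F2_if_not_small by simp
  moreover have "single_self_loop \<Gamma> \<longrightarrow> (\<exists>i j k. i \<noteq> 0 \<and> \<not> (j = 0 \<and> k = 0) \<and> G \<cong> loop_group i j k)"
    unfolding G_eq using iso_loop_group_if_single_self_loop by simp
  moreover have "\<forall>i j k. i \<noteq> 0 \<and> \<not> (j = 0 \<and> k = 0) \<and> G \<cong> loop_group i j k \<longrightarrow>
      (surjects G F2 \<longleftrightarrow> k = 0) \<and> (k \<noteq> 0 \<longrightarrow>
        (\<exists>H. subgroup H G \<and> card (rcosets\<^bsub>G\<^esub> H) = 2 \<and> surjects (G\<lparr>carrier := H\<rparr>) F2))"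
    using loops by blast
  ultimately show ?thesis by blast
qed

end
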